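(* Consider the constrained mechanical system in the penalty ODE formulation described in the context, with an event at time $t_{\rm eve}=t_{\rm eve}(\rho)$ that consists of a change of the equations of motion caused by a change of the constraints ($\Phi^-\to\Phi^+$) included in the equations of motion. Let $V|_{t_{\rm eve}}^{+},V|_{t_{\rm eve}}^{-}\in\mathbb{R}^{n\times p}$ be the sensitivity matrices of the generalized velocities right after and right before the event. Then the sensitivities of the independent velocities right after the event are $$V_{\rm dof-}|_{t_{\rm eve}}^{+}=V_{\rm dof-}|_{t_{\rm eve}}^{-}+\Big(\ddot q_{\rm dof-}|_{t_{\rm eve}}^{-}-\ddot q_{\rm dof-}|_{t_{\rm eve}}^{+}\Big)\cdot\frac{dt_{\rm eve}}{d\rho}.$$
   Context: Notation. $q\in\mathbb{R}^n$ is the generalized position, $v=\dot q\in\mathbb{R}^n$ the velocity, $\ddot q=\dot v$ the acceleration, $\rho\in\mathbb{R}^p$ the parameter vector. For any quantity $x$, $x|_{t_{\rm eve}}^{\pm}=\lim_{\varepsilon\downarrow 0}x(t_{\rm eve}\pm\varepsilon)$. $V(t,\rho)=\frac{dv}{d\rho}(t,\rho)\in\mathbb{R}^{n\times p}$ is the velocity sensitivity (derivative at fixed $t$), and $V|^\pm_{t_{\rm eve}}$ are its one-sided limits in $t$. Penalty ODE formulation. For a smooth position constraint function $\Phi(t,q,\rho)\in\mathbb{R}^m$, the equations of motion are the ODE $\dot q=v$, $\dot v=f^{\rm eom}(t,q,v,\rho)=\overline{\mathsf M}^{-1}\,\overline{\mathsf F}$, where $$\overline{\mathsf M}=\mathsf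 M+\Phi_q^T\alpha\,\Phi_q,\qquad \overline{\mathsf F}=\mathsf F-\Phi_q^T\alpha\big(\dot\Phi_q\,v+\dot\Phi_t+2\xi\omega\,\dot\Phi+\omega^2\Phi\big).$$ Here $\mathsf M$ is the mass matrix, $\mathsf F$ the force vector, $\alpha\in\mathbb{R}^{m\times m}$ the penalty factor, $\xi,\omega\in\mathbb{R}$ constants, subscripts are partial derivatives, and dots are total time derivatives along the motion (with $\dot q=v$); all data are smooth and $\overline{\mathsf M}$ is invertible. Before the event the equations of motion are those built from $\Phi=\Phi^-$ and after the event those built from $\Phi=\Phi^+$ (the numbers of constraints $m^-$, $m^+$ may differ). The initial conditions $q(t_0)=q_0(\rho)$, $v(t_0)=v_0(\rho)$ depend differentiably on $\rho$; the evolution is smooth in time on each side of the event. Event. There are finitely many events (no Zeno behavior); the result concerns one of them, isolated in time. The event time $t_{\rm eve}(\rho)$ is determined by $r\big(q(t_{\rm eve}(\rho),\rho)\big)=0$ with $r:\mathbb{R}^n\to\mathbb{R}$ smooth. There is no grazing, i.e. $\frac{dr}{dq}(q|_{t_{\rm eve}})\cdot v|^-_{t_{\rm eve}}\ne0$. $\frac{dt_{\rm eve}}{d\rho}\in\mathbb{R}^{1\times p}$ is the derivative of $t_{\rm eve}(\rho)$. Positions and velocities do not jump: $q|^+_{t_{\rm eve}}=q|^-_{t_{\rm eve}}$ and $v|^+_{t_{\rm eve}}=v|^-_{t_{\rm eve}}$; only the acceleration is discontinuous. The constraint is satisfied before the event, $\Phi^-|^-_{t_{\rm eve}}=0$, but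 it is not satisfied exactly right after it, $\Phi^+|^+_{t_{\rm eve}}\neq0$. Partitioning. $\mathsf P^{-}$ is an $n\times n$ permutation matrix splitting vectors (and rows of matrices) into before-event dependent and independent components: $\mathsf P^{-}x=\begin{bmatrix}x_{\rm dep-}\\ x_{\rm dof-}\end{bmatrix}$, with $x_{\rm dep-}\in\mathbb{R}^{m^-}$, $x_{\rm dof-}\in\mathbb{R}^{n-m^-}$. It is chosen so that, with $\Phi^-_q$ of full row rank $m^-$ at the event configuration, the first $m^-$ columns of $\Phi_q^-(\mathsf P^-)^T$ form a nonsingular matrix. The subscript dof$-$ may be applied to both before- and after-event values. *)

theory Defs
  imports "HOL-Analysis.Analysis"
begin

text \<open>Meaningful for open \<^term>\<open>S\<close>: membership in $C^k$ on \<^term>\<open>S\<close>, by recursion on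
  directional derivatives.\<close>

primrec Ck_on :: "nat \<Rightarrow> ('a::euclidean_space \<Rightarrow> 'b::real_normed_vector) \<Rightarrow> 'a set \<Rightarrow> bool" where
  "Ck_on 0 f S \<longleftrightarrow> continuous_on S f"
| "Ck_on (Suc k) f S \<longleftrightarrow>
     (\<forall>x\<in>S. f differentiable (at x)) \<and>
     (\<forall>h. Ck_on k (\<lambda>x. frechet_derivative f (at x) h) S)"

definition smooth_on :: "('a::euclidean_space \<Rightarrow> 'b::real_normed_vector) \<Rightarrow> 'a set \<Rightarrow> bool" where
  "smooth_on f S \<longleftrightarrow> (\<forall>k. Ck_on k f S)"

text \<open>A constraint function \<open>\<Phi> t q \<rho>\<close> has one component for each element of the index
  type \<open>'m\<close>; \<open>\<Phi>_q\<close> is the matrix with \<open>CARD('m)\<close> rows and \<open>CARD('n)\<close> columns.\<close>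

definition partial_q ::
  "(real \<Rightarrow> real^'n \<Rightarrow> real^'p \<Rightarrow> real^'m) \<Rightarrow> real \<Rightarrow> real^'n \<Rightarrow> real^'p \<Rightarrow> real^'n^'m" where
  "partial_q \<Phi> t q \<rho> = jacobian (\<lambda>x. \<Phi> t x \<rho>) (at q)"

definition partial_t ::
  "(real \<Rightarrow> real^'n \<Rightarrow> real^'p \<Rightarrow> 'b::real_normed_vector) \<Rightarrow> real \<Rightarrow> real^'n \<Rightarrow> real^'p \<Rightarrow> 'b" where
  "partial_t G t q \<rho> = vector_derivative (\<lambda>s. G s q \<rho>) (at t)"

text \<open>The derivative of \<open>s \<mapsto> G s (q s) \<rho>\<close> along a motion with \<open>q' = v\<close>, that is \<open>G_q v + G_t\<close>.\<close>

definition total_dt ::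
  "(real \<Rightarrow> real^'n \<Rightarrow> real^'p \<Rightarrow> 'b::real_normed_vector) \<Rightarrow>
     real \<Rightarrow> real^'n \<Rightarrow> real^'n \<Rightarrow> real^'p \<Rightarrow> 'b" where
  "total_dt G t q v \<rho> = frechet_derivative (\<lambda>(s, x). G s x \<rho>) (at (t, q)) (1, v)"

definition Mbar ::
  "(real \<Rightarrow> real^'n \<Rightarrow> real^'p \<Rightarrow> real^'n^'n) \<Rightarrow> real^'m^'m \<Rightarrow>
     (real \<Rightarrow> real^'n \<Rightarrow> real^'p \<Rightarrow> real^'m) \<Rightarrow> real \<Rightarrow> real^'n \<Rightarrow> real^'p \<Rightarrow> real^'n^'n" where
  "Mbar M \<alpha> \<Phi> t q \<rho> =
     M t q \<rho> + transpose (partial_q \<Phi> t q \<rho>) ** \<alpha> ** partial_q \<Phi> t q \<rho>"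

definition Fbar ::
  "(real \<Rightarrow> real^'n \<Rightarrow> real^'n \<Rightarrow> real^'p \<Rightarrow> real^'n) \<Rightarrow> real^'m^'m \<Rightarrow> real \<Rightarrow> real \<Rightarrow>
     (real \<Rightarrow> real^'n \<Rightarrow> real^'p \<Rightarrow> real^'m) \<Rightarrow>
     real \<Rightarrow> real^'n \<Rightarrow> real^'n \<Rightarrow> real^'p \<Rightarrow> real^'n" where
  "Fbar F \<alpha> \<xi> \<omega> \<Phi> t q v \<rho> =
     F t q v \<rho> -
       (transpose (partial_q \<Phi> t q \<rho>) ** \<alpha>) *v
         (total_dt (partial_q \<Phi>) t q v \<rho> *v v + total_dt (partial_t \<Phi>) t q v \<rho> +
          (2 * \<xi> * \<omega>) *\<^sub>R total_dt \<Phi> t q v \<rho> + \<omega>\<^sup>2 *\<^sub>R \<Phi> t q \<rho>)"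

definition f_eom ::
  "(real \<Rightarrow> real^'n \<Rightarrow> real^'p \<Rightarrow> real^'n^'n) \<Rightarrow>
     (real \<Rightarrow> real^'n \<Rightarrow> real^'n \<Rightarrow> real^'p \<Rightarrow> real^'n) \<Rightarrow> real^'m^'m \<Rightarrow> real \<Rightarrow> real \<Rightarrow>
     (real \<Rightarrow> real^'n \<Rightarrow> real^'p \<Rightarrow> real^'m) \<Rightarrow>
     real \<Rightarrow> real^'n \<Rightarrow> real^'n \<Rightarrow> real^'p \<Rightarrow> real^'n" where
  "f_eom M F \<alpha> \<xi> \<omega> \<Phi> t q v \<rho> =
     matrix_inv (Mbar M \<alpha> \<Phi> t q \<rho>) *v Fbar F \<alpha> \<xi> \<omega> \<Phi> t q v \<rho>"

definition solves_eom ::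
  "(real \<Rightarrow> real^'n \<Rightarrow> real^'n \<Rightarrow> real^'p \<Rightarrow> real^'n) \<Rightarrow>
     (real \<Rightarrow> real^'p \<Rightarrow> real^'n) \<Rightarrow> (real \<Rightarrow> real^'p \<Rightarrow> real^'n) \<Rightarrow>
     real set \<Rightarrow> real^'p \<Rightarrow> bool" where
  "solves_eom f q v T \<rho> \<longleftrightarrow>
     (\<forall>t\<in>T. ((\<lambda>s. q s \<rho>) has_vector_derivative v t \<rho>) (at t) \<and>
             ((\<lambda>s. v s \<rho>) has_vector_derivative f t (q t \<rho>) (v t \<rho>) \<rho>) (at t))"

definition acceleration :: "(real \<Rightarrow> real^'p \<Rightarrow> real^'n) \<Rightarrow> real \<Rightarrow> real^'p \<Rightarrow> real^'n" where
  "acceleration v t \<rho> = vector_derivative (\<lambda>s. v s \<rho>) (at t)"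

definition velocity_sensitivity :: "(real \<Rightarrow> real^'p \<Rightarrow> real^'n) \<Rightarrow> real \<Rightarrow> real^'p \<Rightarrow> real^'p^'n" where
  "velocity_sensitivity v t \<rho> = jacobian (v t) (at \<rho>)"

definition row_derivative :: "(real^'p \<Rightarrow> real) \<Rightarrow> real^'p \<Rightarrow> real^'p^1" where
  "row_derivative \<tau> \<rho> = jacobian (\<lambda>\<rho>'. vec (\<tau> \<rho>') :: real^1) (at \<rho>)"

text \<open>The rows of a partitioning matrix are indexed by the sum type \<open>'m + 'd\<close>, so that
  \<open>P *v x\<close> is literally a vector consisting of a dependent block (\<open>Inl\<close>, of size
  \<open>CARD('m)\<close>) on top of an independent block (\<open>Inr\<close>, of size \<open>CARD('d)\<close>).
  The bijection forces \<open>CARD('n) = CARD('m) + CARD('d)\<close>.\<close>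

definition permutation_matrix :: "real^'n^('m::finite + 'd::finite) \<Rightarrow> bool" where
  "permutation_matrix P \<longleftrightarrow>
     (\<exists>\<sigma> :: 'm + 'd \<Rightarrow> 'n. bij \<sigma> \<and> P = (\<chi> i j. if j = \<sigma> i then 1 else 0))"

definition dof_part :: "real^'n^('m::finite + 'd::finite) \<Rightarrow> real^'n \<Rightarrow> real^'d" where
  "dof_part P x = (\<chi> i. (P *v x) $ Inr i)"

definition dof_rows :: "real^'n^('m::finite + 'd::finite) \<Rightarrow> real^'p^'n \<Rightarrow> real^'p^'d" where
  "dof_rows P A = (\<chi> i. (P ** A) $ Inr i)"

definition dep_columns :: "real^'n^('m::finite + 'd::finite) \<Rightarrow> real^'n^'k \<Rightarrow> real^'m^'k" where
  "dep_columns P A = (\<chi> i j. (A ** transpose P) $ i $ Inl j)"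

end

theory Submission
  imports Defs
begin

text \<open>Both one-sided phases determine the derivative of the event velocity
  \<open>\<sigma> \<mapsto> v (teve \<sigma>) \<sigma>\<close> at \<open>\<rho>\<close>: by the chain rule, in the limit towards the event, it equals
  \<open>h \<mapsto> Vm h + (teve' h) am\<close> and also \<open>h \<mapsto> Vp h + (teve' h) ap\<close>. Uniqueness of the derivative gives
  the jump of the whole sensitivity matrix, and the independent rows are read off. Passing to the
  limit needs a bound, uniform up to the event, on how the accelerations depend on the parameter;
  it comes from Gronwall's inequality, since the right-hand side of the equations of motion is
  locally Lipschitz near the motion (by Cramer's rule for the inverse of \<open>Mbar\<close>).\<close>

subsection \<open>Locally Lipschitz maps\<close>

text \<open>Differentiability in the parameter is assumed for \<open>v t\<close> only at fixed times
  other than \<open>teve \<rho>\<close>, and \<open>Vm\<close>, \<open>Vp\<close> are mere limits of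
  those derivatives, so no chain rule applies directly at the event. Moreover, times between
  \<open>teve \<rho>\<close> and \<open>teve \<sigma>\<close> lie in different phases of the motions
  for \<open>\<rho>\<close> and \<open>\<sigma>\<close>, so that comparing the two at equal times
  would mix the two right-hand sides. Each phase is therefore compared only with itself, after time
  has been scaled so that the two event times coincide.

  The estimates run on the pair \<open>(q, v)\<close>, because the acceleration depends on the
  positions as well, although the conclusion is about velocities. Data for the phase after the event
  are available only at the event itself: continuity identifies them with the final state of the
  phase before it, so the bound obtained for the first phase is the starting bound of the second,
  which is then followed away from the event.\<close>

definition lipschitz_near :: "('a::metric_space \<Rightarrow> 'b::metric_space) \<Rightarrow> 'a \<Rightarrow> bool" where
  "lipschitz_near f z \<longleftrightarrow> (\<exists>\<epsilon>>0. \<exists>L. L-lipschitz_on (ball z \<epsilon>) f)"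

lemma lipschitz_near_imp_isCont: "lipschitz_near f z \<Longrightarrow> isCont f z"
  unfolding lipschitz_near_def
  by (metis centre_in_ball continuous_on_interior interior_open lipschitz_on_continuous_on open_ball)

text \<open>Needed for formulas that hold only near a point: Cramer's rule where the determinant is
  nonzero, and the expansion of \<open>total_dt\<close> over the open parameter set.\<close>

lemma lipschitz_near_cong:
  assumes "\<forall>\<^sub>F x in nhds z. f x = g x" "lipschitz_near f z"
  shows "lipschitz_near g z"
proof -
  obtain d where d: "d > 0" "\<And>x. dist x z < d \<Longrightarrow> f x = g x"
    using assms(1) by (auto simp: eventually_nhds_metric)
  obtain \<epsilon> L where e: "\<epsilon> > 0" "L-lipschitz_on (ball z \<epsilon>) f"
    using assms(2) by (auto simp: lipschitz_near_def)
  have "L-lipschitz_on (ball z (min d \<epsilon>)) f"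
    by (rule lipschitz_on_subset[OF e(2)]) auto
  then have "L-lipschitz_on (ball z (min d \<epsilon>)) g"
    by (rule lipschitz_on_transform) (auto simp: dist_commute d(2))
  then show ?thesis
    unfolding lipschitz_near_def using d e by (intro exI[of _ "min d \<epsilon>"]) auto
qed

lemma lipschitz_near_compose:
  assumes "lipschitz_near f z" "lipschitz_near g (f z)"
  shows "lipschitz_near (\<lambda>x. g (f x)) z"
proof -
  obtain \<epsilon> L where e: "\<epsilon> > 0" "L-lipschitz_on (ball z \<epsilon>) f"
    using assms by (auto simp: lipschitz_near_def)
  obtain \<delta> K where d: "\<delta> > 0" "K-lipschitz_on (ball (f z) \<delta>) g"
    using assms by (auto simp: lipschitz_near_def)
  obtain \<eta> where \<eta>: "\<eta> > 0" "\<And>x. dist x z < \<eta> \<Longrightarrow> dist (f x) (f z) < \<delta>"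
    using lipschitz_near_imp_isCont[OF assms(1)] d(1) unfolding continuous_at_eps_delta by blast
  have "L-lipschitz_on (ball z (min \<eta> \<epsilon>)) f"
    by (rule lipschitz_on_subset[OF e(2)]) auto
  moreover have "K-lipschitz_on (f ` ball z (min \<eta> \<epsilon>)) g"
    by (rule lipschitz_on_subset[OF d(2)]) (auto simp: dist_commute \<eta>(2))
  ultimately have "(K * L)-lipschitz_on (ball z (min \<eta> \<epsilon>)) (\<lambda>x. g (f x))"
    by (rule lipschitz_on_compose2)
  then show ?thesis
    unfolding lipschitz_near_def using \<eta> e by (intro exI[of _ "min \<eta> \<epsilon>"]) auto
qed

lemma lipschitz_near_const: "lipschitz_near (\<lambda>x. c) z"
  unfolding lipschitz_near_def using lipschitz_on_constant zero_less_one by blast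

lemma lipschitz_near_bounded_linear: "bounded_linear f \<Longrightarrow> lipschitz_near f z"
  unfolding lipschitz_near_def by (metis bounded_linear.lipschitz_boundE zero_less_one)

lemma lipschitz_near_Pair:
  assumes "lipschitz_near f z" "lipschitz_near g z"
  shows "lipschitz_near (\<lambda>x. (f x, g x)) z"
proof -
  obtain \<epsilon> L where e: "\<epsilon> > 0" "L-lipschitz_on (ball z \<epsilon>) f"
    using assms by (auto simp: lipschitz_near_def)
  obtain \<delta> K where d: "\<delta> > 0" "K-lipschitz_on (ball z \<delta>) g"
    using assms by (auto simp: lipschitz_near_def)
  have "L-lipschitz_on (ball z (min \<delta> \<epsilon>)) f" "K-lipschitz_on (ball z (min \<delta> \<epsilon>)) g"
    by (rule lipschitz_on_subset[OF e(2)] lipschitz_on_subset[OF d(2)], force)+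
  from lipschitz_on_Pair[OF this] show ?thesis
    unfolding lipschitz_near_def using d e by (intro exI[of _ "min \<delta> \<epsilon>"]) auto
qed

lemma lipschitz_near_bounded_bilinear:
  fixes mul :: "'b::real_normed_vector \<Rightarrow> 'c::real_normed_vector \<Rightarrow> 'd::real_normed_vector"
  assumes "bounded_bilinear mul" "lipschitz_near f z" "lipschitz_near g z"
  shows "lipschitz_near (\<lambda>x. mul (f x) (g x)) z"
proof -
  interpret bounded_bilinear mul by fact
  obtain K where K: "K > 0" "\<And>a b. norm (mul a b) \<le> norm a * norm b * K"
    using pos_bounded by blast
  have "lipschitz_near (\<lambda>(a, b). mul a b) (a, b)" for a b
  proof -
    \<comment> \<open>A bilinear map is Lipschitz only on bounded sets. On the unit ball the factors
      are bounded by \<open>norm a + 1\<close> and \<open>norm b + 1\<close>, whose sum gives the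
      constant.\<close>
    have "((norm a + norm b + 2) * K)-lipschitz_on (ball (a, b) 1) (\<lambda>(a, b). mul a b)"
    proof (rule lipschitz_onI)
      fix x y assume xy: "x \<in> ball (a, b) 1" "y \<in> ball (a, b) 1"
      obtain x1 x2 y1 y2 where eq: "x = (x1, x2)" "y = (y1, y2)" by fastforce
      have "dist a y1 \<le> dist (a, b) (y1, y2)" "dist b x2 \<le> dist (a, b) (x1, x2)"
        using dist_fst_le[of "(a,b)" "(y1,y2)"] dist_snd_le[of "(a,b)" "(x1,x2)"] by simp_all
      then have "norm (y1 - a) \<le> 1" "norm (x2 - b) \<le> 1"
        using xy by (auto simp: eq dist_norm norm_minus_commute)
      then have n: "norm y1 \<le> norm a + 1" "norm x2 \<le> norm b + 1"
        using norm_triangle_sub[of y1 a] norm_triangle_sub[of x2 b] by linarith+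
      have d: "norm (x1 - y1) \<le> dist x y" "norm (x2 - y2) \<le> dist x y"
        using dist_fst_le[of x y] dist_snd_le[of x y] by (simp_all add: eq dist_norm)
      have "mul x1 x2 - mul y1 y2 = mul (x1 - y1) x2 + mul y1 (x2 - y2)"
        by (simp add: diff_left diff_right)
      then have "norm (mul x1 x2 - mul y1 y2) \<le> norm (mul (x1 - y1) x2) + norm (mul y1 (x2 - y2))"
        using norm_triangle_ineq by simp
      also have "\<dots> \<le> norm (x1 - y1) * norm x2 * K + norm y1 * norm (x2 - y2) * K"
        by (intro add_mono K)
      also have "\<dots> \<le> dist x y * (norm b + 1) * K + (norm a + 1) * dist x y * K"
        using n d K(1) by (intro add_mono mult_mono) auto
      finally show "dist (case x of (a, b) \<Rightarrow> mul a b) (case y of (a, b) \<Rightarrow> mul a b)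
          \<le> (norm a + norm b + 2) * K * dist x y"
        by (simp add: eq dist_norm algebra_simps)
    qed (use K in auto)
    then show ?thesis
      unfolding lipschitz_near_def using zero_less_one by blast
  qed
  from lipschitz_near_compose[OF lipschitz_near_Pair[OF assms(2,3)] this] show ?thesis
    by simp
qed

lemma lipschitz_near_linear_compose:
  assumes "bounded_linear A" "lipschitz_near f z"
  shows "lipschitz_near (\<lambda>x. A (f x)) z"
  using lipschitz_near_compose[OF assms(2) lipschitz_near_bounded_linear[OF assms(1)]] .

lemma lipschitz_near_add:
  fixes f g :: "'a::metric_space \<Rightarrow> 'b::real_normed_vector"
  assumes "lipschitz_near f z" "lipschitz_near g z"
  shows "lipschitz_near (\<lambda>x. f x + g x) z"
  using lipschitz_near_linear_compose[OF _ lipschitz_near_Pair[OF assms], of "\<lambda>p. fst p + snd p"]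
  by (simp add: bounded_linear_add bounded_linear_fst bounded_linear_snd)

lemma lipschitz_near_diff:
  fixes f g :: "'a::metric_space \<Rightarrow> 'b::real_normed_vector"
  assumes "lipschitz_near f z" "lipschitz_near g z"
  shows "lipschitz_near (\<lambda>x. f x - g x) z"
  using lipschitz_near_linear_compose[OF _ lipschitz_near_Pair[OF assms], of "\<lambda>p. fst p - snd p"]
  by (simp add: bounded_linear_sub bounded_linear_fst bounded_linear_snd)

lemma lipschitz_near_sum:
  fixes f :: "'i \<Rightarrow> 'a::metric_space \<Rightarrow> 'b::real_normed_vector"
  assumes "\<And>i. i \<in> I \<Longrightarrow> lipschitz_near (f i) z"
  shows "lipschitz_near (\<lambda>x. \<Sum>i\<in>I. f i x) z"
  using assms
  by (induction I rule: infinite_finite_induct) (auto intro: lipschitz_near_const lipschitz_near_add)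

lemma lipschitz_near_prod:
  fixes f :: "'i \<Rightarrow> 'a::metric_space \<Rightarrow> real"
  assumes "\<And>i. i \<in> I \<Longrightarrow> lipschitz_near (f i) z"
  shows "lipschitz_near (\<lambda>x. \<Prod>i\<in>I. f i x) z"
  using assms
  by (induction I rule: infinite_finite_induct)
    (auto intro: lipschitz_near_const lipschitz_near_bounded_bilinear[OF bounded_bilinear_mult])

section \<open>Reduction to components, determinants and the reciprocal\<close>

lemma bounded_linear_axis: "bounded_linear (axis i :: 'b::euclidean_space \<Rightarrow> 'b^'n)"
  unfolding linear_conv_bounded_linear[symmetric]
  by (rule linearI) (auto simp: vec_eq_iff axis_def)

lemma sum_axis_nth: "(\<Sum>i\<in>UNIV. axis i (x $ i)) = (x :: 'b::euclidean_space^'n)"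
  by (simp add: vec_eq_iff axis_def if_distrib cong: if_cong)

text \<open>A vector is the finite sum of its components placed along the axes, and each placement
  is bounded linear.\<close>

lemma lipschitz_near_vec:
  fixes f :: "'a::metric_space \<Rightarrow> 'b::euclidean_space^'n"
  assumes "\<And>i. lipschitz_near (\<lambda>x. f x $ i) z"
  shows "lipschitz_near f z"
proof -
  have "lipschitz_near (\<lambda>x. \<Sum>i\<in>UNIV. axis i (f x $ i)) z"
    by (intro lipschitz_near_sum lipschitz_near_linear_compose[OF bounded_linear_axis] assms)
  then show ?thesis by (simp add: sum_axis_nth)
qed

lemma lipschitz_near_det:
  fixes A :: "'a::metric_space \<Rightarrow> real^'n^'n"
  assumes "\<And>i j. lipschitz_near (\<lambda>x. A x $ i $ j) z"
  shows "lipschitz_near (\<lambda>x. det (A x)) z"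
  unfolding det_def
  by (intro lipschitz_near_sum lipschitz_near_bounded_bilinear[OF bounded_bilinear_mult]
      lipschitz_near_const lipschitz_near_prod assms)

lemma lipschitz_near_inverse:
  fixes a :: real
  assumes "a \<noteq> 0"
  shows "lipschitz_near inverse a"
proof -
  \<comment> \<open>Within distance \<open>\<bar>a\<bar> / 2\<close> of \<open>a\<close> every point
    has absolute value at least \<open>\<bar>a\<bar> / 2\<close>, so the denominator
    \<open>x * y\<close> of the difference is at least \<open>a\<^sup>2 / 4\<close> in absolute
    value.\<close>
  have "(4 / a\<^sup>2)-lipschitz_on (ball a (\<bar>a\<bar> / 2)) inverse"
  proof (rule lipschitz_onI)
    fix x y assume "x \<in> ball a (\<bar>a\<bar> / 2)" "y \<in> ball a (\<bar>a\<bar> / 2)"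
    then have x: "\<bar>x\<bar> \<ge> \<bar>a\<bar> / 2" and y: "\<bar>y\<bar> \<ge> \<bar>a\<bar> / 2"
      by (auto simp: dist_real_def abs_real_def split: if_splits)
    have nz: "x \<noteq> 0" "y \<noteq> 0" using x y assms by auto
    have "\<bar>a\<bar> / 2 * (\<bar>a\<bar> / 2) \<le> \<bar>x\<bar> * \<bar>y\<bar>"
      using x y by (intro mult_mono) auto
    then have xy: "a\<^sup>2 / 4 \<le> \<bar>x\<bar> * \<bar>y\<bar>"
      by (simp add: power2_eq_square flip: abs_mult)
    have "inverse x - inverse y = (y - x) / (x * y)"
      using nz by (simp add: field_simps)
    then have "dist (inverse x) (inverse y) = dist x y / (\<bar>x\<bar> * \<bar>y\<bar>)"
      by (simp add: dist_real_def abs_mult abs_minus_commute)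
    also have "\<dots> \<le> dist x y / (a\<^sup>2 / 4)"
      using xy assms by (intro divide_left_mono) (auto intro!: mult_pos_pos simp: nz)
    finally show "dist (inverse x) (inverse y) \<le> 4 / a\<^sup>2 * dist x y"
      by (simp add: field_simps)
  qed simp
  then show ?thesis
    unfolding lipschitz_near_def using assms by (intro exI[of _ "\<bar>a\<bar> / 2"]) auto
qed

section \<open>Matrix products and the inverse matrix\<close>

lemma bounded_bilinear_matrix_vector_mult: "bounded_bilinear ((*v) :: real^'n^'m \<Rightarrow> real^'n \<Rightarrow> real^'m)"
  unfolding bilinear_conv_bounded_bilinear[symmetric] bilinear_def
  by (auto intro!: linearI simp: vec_eq_iff matrix_vector_mult_def sum.distrib sum_distrib_left algebra_simps)

lemma bounded_bilinear_matrix_matrix_mult: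
  "bounded_bilinear ((**) :: real^'k^'m \<Rightarrow> real^'n^'k \<Rightarrow> real^'n^'m)"
  unfolding bilinear_conv_bounded_bilinear[symmetric] bilinear_def
  by (auto intro!: linearI simp: vec_eq_iff matrix_matrix_mult_def sum.distrib sum_distrib_left algebra_simps)

lemma bounded_linear_transpose: "bounded_linear (transpose :: real^'n^'m \<Rightarrow> real^'m^'n)"
  unfolding linear_conv_bounded_linear[symmetric]
  by (rule linearI) (auto simp: transpose_def vec_eq_iff)

text \<open>\<open>matrix_inv\<close> is given by a choice operator and shows no regularity by
  itself. Cramer's rule turns its action on a vector into a rational expression in the
  entries.\<close>

lemma matrix_inv_mult_eq_cramer:
  fixes A :: "real^'n^'n"
  assumes "det A \<noteq> 0"
  shows "matrix_inv A *v b = (\<chi> k. inverse (det A) * det (\<chi> i j. if j = k then b $ i else A $ i $ j))"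
proof -
  have "A ** matrix_inv A = mat 1"
    using assms unfolding matrix_inv_def invertible_det_nz[symmetric] invertible_def
    by (metis (mono_tags, lifting) someI_ex)
  then have "A *v (matrix_inv A *v b) = b"
    by (simp add: matrix_vector_mul_assoc)
  then show ?thesis
    by (simp add: cramer[OF assms] field_simps)
qed

text \<open>Invertibility at the single point \<open>z\<close> is enough: the determinant is
  continuous there, hence nonzero nearby, and Cramer's formula holds on that neighbourhood.\<close>

lemma lipschitz_near_matrix_inv_mult:
  fixes A :: "'a::metric_space \<Rightarrow> real^'n^'n" and b :: "'a \<Rightarrow> real^'n"
  assumes A: "lipschitz_near A z" and b: "lipschitz_near b z" and inv: "invertible (A z)"
  shows "lipschitz_near (\<lambda>x. matrix_inv (A x) *v b x) z"
proof (rule lipschitz_near_cong)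
  have Aij: "lipschitz_near (\<lambda>x. A x $ i $ j) z" for i j
    using lipschitz_near_linear_compose[OF bounded_linear_compose A] bounded_linear_vec_nth by blast
  have bi: "lipschitz_near (\<lambda>x. b x $ i) z" for i
    using lipschitz_near_linear_compose[OF _ b] bounded_linear_vec_nth by blast
  have detA: "lipschitz_near (\<lambda>x. det (A x)) z"
    by (rule lipschitz_near_det[OF Aij])
  have nz: "det (A z) \<noteq> 0" using inv by (simp add: invertible_det_nz)
  have "((\<lambda>x. det (A x)) \<longlongrightarrow> det (A z)) (nhds z)"
    using lipschitz_near_imp_isCont[OF detA] isCont_def tendsto_at_iff_tendsto_nhds by blast
  then have "\<forall>\<^sub>F x in nhds z. det (A x) \<noteq> 0"
    using nz tendsto_imp_eventually_ne by blast
  then show "\<forall>\<^sub>F x in nhds z. (\<chi> k. inverse (det (A x)) *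
      det (\<chi> i j. if j = k then b x $ i else A x $ i $ j)) = matrix_inv (A x) *v b x"
    by eventually_elim (rule matrix_inv_mult_eq_cramer[symmetric])
  have "lipschitz_near (\<lambda>x. det (\<chi> i j. if j = k then b x $ i else A x $ i $ j)) z" for k
  proof (rule lipschitz_near_det)
    show "lipschitz_near (\<lambda>x. (\<chi> i j. if j = k then b x $ i else A x $ i $ j) $ i $ j) z" for i j
      using Aij bi by (cases "j = k") simp_all
  qed
  then show "lipschitz_near (\<lambda>x. \<chi> k. inverse (det (A x)) *
      det (\<chi> i j. if j = k then b x $ i else A x $ i $ j)) z"
    by (intro lipschitz_near_vec)
      (simp add: lipschitz_near_bounded_bilinear[OF bounded_bilinear_mult]
        lipschitz_near_compose[OF detA lipschitz_near_inverse[OF nz]])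
qed

subsection \<open>Regularity of the equations of motion\<close>

text \<open>On an open set two functions that agree have the same derivatives, so the directional
  derivatives agree as well and the induction can pass to them; hence \<open>f\<close> and
  \<open>g\<close> are generalized.\<close>

lemma Ck_on_cong:
  assumes "open S" "\<And>x. x \<in> S \<Longrightarrow> f x = g x" "Ck_on k f S"
  shows "Ck_on k g S"
  using assms(2,3)
proof (induction k arbitrary: f g)
  case 0
  then show ?case by (metis Ck_on.simps(1) continuous_on_cong)
next
  case (Suc k)
  have D: "(g has_derivative frechet_derivative f (at x)) (at x)" if "x \<in> S" for x
    using Suc.prems that assms(1)
    by (auto simp: frechet_derivative_works intro: has_derivative_transform_within_open)
  have "Ck_on k (\<lambda>x. frechet_derivative g (at x) h) S" for h
  proof (rule Suc.IH)
    show "Ck_on k (\<lambda>x. frechet_derivative f (at x) h) S" using Suc.prems by simp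
  qed (use frechet_derivative_at[OF D] in simp)
  then show ?case using D by (auto simp: differentiable_def)
qed

text \<open>The directional derivatives of the composite are \<open>A\<close> applied to those of
  \<open>f\<close>, which is again the form covered by the induction hypothesis.\<close>

lemma Ck_on_bounded_linear:
  assumes "open S" "bounded_linear A" "Ck_on k f S"
  shows "Ck_on k (\<lambda>x. A (f x)) S"
  using assms(3)
proof (induction k arbitrary: f)
  case 0
  then show ?case
    using linear_continuous_on_compose bounded_linear.continuous_on[OF assms(2)] by auto
next
  case (Suc k)
  have D: "((\<lambda>x. A (f x)) has_derivative (\<lambda>h. A (frechet_derivative f (at x) h))) (at x)"
    if "x \<in> S" for x
    using Suc.prems that
    by (auto simp: frechet_derivative_works intro: bounded_linear.has_derivative[OF assms(2)])
  have "Ck_on k (\<lambda>x. frechet_derivative (\<lambda>x. A (f x)) (at x) h) S" for h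
  proof (rule Ck_on_cong[OF assms(1)])
    show "Ck_on k (\<lambda>x. A (frechet_derivative f (at x) h)) S" using Suc by simp
    show "A (frechet_derivative f (at x) h) = frechet_derivative (\<lambda>x. A (f x)) (at x) h"
      if "x \<in> S" for x
      using fun_cong[OF frechet_derivative_at[OF D[OF that]]] .
  qed
  then show ?case using D by (auto simp: differentiable_def)
qed

lemma Ck_on_zero: "Ck_on k (\<lambda>x. 0) S"
  by (induction k) simp_all

lemma Ck_on_add:
  assumes "open S" "Ck_on k f S" "Ck_on k g S"
  shows "Ck_on k (\<lambda>x. f x + g x) S"
  using assms(2,3)
proof (induction k arbitrary: f g)
  case 0
  then show ?case by (simp add: continuous_on_add)
next
  case (Suc k)
  have D: "((\<lambda>x. f x + g x) has_derivative
      (\<lambda>h. frechet_derivative f (at x) h + frechet_derivative g (at x) h)) (at x)"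
    if "x \<in> S" for x
    using Suc.prems that
    by (auto simp: frechet_derivative_works intro: has_derivative_add)
  have "Ck_on k (\<lambda>x. frechet_derivative (\<lambda>x. f x + g x) (at x) h) S" for h
  proof (rule Ck_on_cong[OF assms(1)])
    show "Ck_on k (\<lambda>x. frechet_derivative f (at x) h + frechet_derivative g (at x) h) S"
      using Suc by simp
    show "frechet_derivative f (at x) h + frechet_derivative g (at x) h =
        frechet_derivative (\<lambda>x. f x + g x) (at x) h" if "x \<in> S" for x
      using fun_cong[OF frechet_derivative_at[OF D[OF that]]] .
  qed
  then show ?case using D by (auto simp: differentiable_def)
qed

lemma smooth_on_cong:
  "open S \<Longrightarrow> (\<And>x. x \<in> S \<Longrightarrow> f x = g x) \<Longrightarrow> smooth_on f S \<Longrightarrow> smooth_on g S"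
  using Ck_on_cong unfolding smooth_on_def by blast

lemma smooth_on_bounded_linear:
  "open S \<Longrightarrow> bounded_linear A \<Longrightarrow> smooth_on f S \<Longrightarrow> smooth_on (\<lambda>x. A (f x)) S"
  using Ck_on_bounded_linear unfolding smooth_on_def by blast

lemma smooth_on_sum:
  assumes "open S" "\<And>i. i \<in> I \<Longrightarrow> smooth_on (f i) S"
  shows "smooth_on (\<lambda>x. \<Sum>i\<in>I. f i x) S"
  using assms(2)
  by (induction I rule: infinite_finite_induct)
    (auto simp: smooth_on_def intro: Ck_on_zero Ck_on_add[OF assms(1)])

lemma smooth_on_imp_differentiable: "smooth_on f S \<Longrightarrow> x \<in> S \<Longrightarrow> f differentiable (at x)"
  unfolding smooth_on_def using Ck_on.simps(2) by blast

lemma smooth_on_frechet_derivative: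
  "smooth_on f S \<Longrightarrow> smooth_on (\<lambda>x. frechet_derivative f (at x) h) S"
  unfolding smooth_on_def using Ck_on.simps(2) by blast

text \<open>Mean value inequality on a ball, which is convex, with a bound on the derivative that is
  uniform there.\<close>

lemma smooth_on_imp_lipschitz_near:
  fixes f :: "'a::euclidean_space \<Rightarrow> 'b::real_normed_vector"
  assumes "smooth_on f S" "open S" "z \<in> S"
  shows "lipschitz_near f z"
proof -
  let ?D = "\<lambda>x. frechet_derivative f (at x)"
  \<comment> \<open>\<open>Ck_on\<close> gives continuity of each directional derivative, not of the
    operator norm. The sum over the basis directions is continuous and dominates the operator
    norm.\<close>
  define B where "B = (\<lambda>x. \<Sum>b\<in>Basis. norm (?D x b))"
  have D: "(f has_derivative ?D x) (at x)" if "x \<in> S" for x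
    using smooth_on_imp_differentiable[OF assms(1) that] frechet_derivative_works by blast
  have "Ck_on (Suc 0) f S" using assms(1) unfolding smooth_on_def by blast
  then have "continuous_on S (\<lambda>x. ?D x b)" for b by simp
  then have "continuous_on S B" unfolding B_def by (intro continuous_intros)
  then have "isCont B z" using assms continuous_on_eq_continuous_at by blast
  then obtain \<delta> where \<delta>: "\<delta> > 0" "\<And>x. dist x z < \<delta> \<Longrightarrow> dist (B x) (B z) < 1"
    unfolding continuous_at_eps_delta using zero_less_one by blast
  obtain \<epsilon> where \<epsilon>: "\<epsilon> > 0" "ball z \<epsilon> \<subseteq> S" using assms openE by blast
  let ?U = "ball z (min \<delta> \<epsilon>)"
  have "(B z + 1)-lipschitz_on ?U f"
  proof (rule lipschitz_onI)
    fix x y assume xy: "x \<in> ?U" "y \<in> ?U"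
    have "norm (f x - f y) \<le> (B z + 1) * norm (x - y)"
    proof (rule differentiable_bound[OF convex_ball _ _ xy])
      fix w assume w: "w \<in> ?U"
      then have wS: "w \<in> S" using \<epsilon> by auto
      show "(f has_derivative ?D w) (at w within ?U)"
        using D[OF wS] by (rule has_derivative_at_withinI)
      have bl: "bounded_linear (?D w)" using D[OF wS] by (rule has_derivative_bounded_linear)
      have "norm (?D w h) \<le> B w * norm h" for h
      proof -
        have "?D w h = (\<Sum>b\<in>Basis. (h \<bullet> b) *\<^sub>R ?D w b)"
          by (subst euclidean_representation[of h, symmetric])
            (simp add: linear_sum[OF bounded_linear.linear[OF bl]]
              linear_scale[OF bounded_linear.linear[OF bl]])
        also have "norm \<dots> \<le> (\<Sum>b\<in>Basis. norm h * norm (?D w b))"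
          by (intro sum_norm_le) (auto intro!: mult_right_mono Basis_le_norm)
        finally show ?thesis by (simp add: B_def sum_distrib_left mult.commute)
      qed
      then have "onorm (?D w) \<le> B w"
        by (intro onorm_bound) (auto simp: B_def sum_nonneg)
      moreover have "B w < B z + 1"
        using \<delta>(2)[of w] w by (auto simp: dist_real_def dist_commute)
      ultimately show "onorm (?D w) \<le> B z + 1" by linarith
    qed
    then show "dist (f x) (f y) \<le> (B z + 1) * dist x y" by (simp add: dist_norm)
  qed (simp add: B_def sum_nonneg add_nonneg_nonneg)
  then show ?thesis
    unfolding lipschitz_near_def using \<delta> \<epsilon> by (intro exI[of _ "min \<delta> \<epsilon>"]) auto
qed

text \<open>\<open>total_dt\<close> freezes the parameter. As a value of the joint derivative in a
  direction with zero parameter component, it can be studied while the parameter varies; the next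
  two lemmas do the same for the partial derivatives.\<close>

lemma total_dt_eq:
  assumes "(\<lambda>(t, x, \<rho>). G t x \<rho>) differentiable (at (t, q, \<rho>))"
  shows "total_dt G t q v \<rho> = frechet_derivative (\<lambda>(t, x, \<rho>). G t x \<rho>) (at (t, q, \<rho>)) (1, v, 0)"
proof -
  let ?H = "\<lambda>(t, x, \<rho>). G t x \<rho>"
  have "(?H has_derivative frechet_derivative ?H (at (t, q, \<rho>))) (at (t, q, \<rho>))"
    using assms frechet_derivative_works by blast
  then have "(?H \<circ> (\<lambda>p. (fst p, snd p, \<rho>)) has_derivative
      frechet_derivative ?H (at (t, q, \<rho>)) \<circ> (\<lambda>h. (fst h, snd h, 0))) (at (t, q))"
    by (intro diff_chain_at) (auto intro!: derivative_eq_intros)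
  from fun_cong[OF frechet_derivative_at[OF this], of "(1, v)"] show ?thesis
    unfolding total_dt_def by (simp add: o_def case_prod_unfold)
qed

lemma partial_t_eq:
  assumes "(\<lambda>(t, x, \<rho>). G t x \<rho>) differentiable (at (t, q, \<rho>))"
  shows "partial_t G t q \<rho> = frechet_derivative (\<lambda>(t, x, \<rho>). G t x \<rho>) (at (t, q, \<rho>)) (1, 0, 0)"
proof -
  let ?H = "\<lambda>(t, x, \<rho>). G t x \<rho>"
  have D: "(?H has_derivative frechet_derivative ?H (at (t, q, \<rho>))) (at (t, q, \<rho>))"
    using assms frechet_derivative_works by blast
  then have "(?H \<circ> (\<lambda>s. (s, q, \<rho>)) has_derivative
      frechet_derivative ?H (at (t, q, \<rho>)) \<circ> (\<lambda>h. (h, 0, 0))) (at t)"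
    by (intro diff_chain_at) (auto intro!: derivative_eq_intros simp: zero_prod_def)
  then have "((\<lambda>s. G s q \<rho>) has_derivative
      (\<lambda>h. frechet_derivative ?H (at (t, q, \<rho>)) (h, 0, 0))) (at t)"
    by (simp add: o_def)
  moreover have "(\<lambda>h. frechet_derivative ?H (at (t, q, \<rho>)) (h, 0, 0)) =
      (\<lambda>h. h *\<^sub>R frechet_derivative ?H (at (t, q, \<rho>)) (1, 0, 0))"
    using linear_scale[OF has_derivative_linear[OF D], of _ "(1, 0, 0)", symmetric] by simp
  ultimately have "((\<lambda>s. G s q \<rho>) has_vector_derivative
      frechet_derivative ?H (at (t, q, \<rho>)) (1, 0, 0)) (at t)"
    by (simp only: has_vector_derivative_def)
  then show ?thesis
    unfolding partial_t_def by (rule vector_derivative_at)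
qed

text \<open>The Jacobian is written as a sum of single-column matrices, each a linear image of a
  derivative in a fixed direction, so that \<open>smooth_on_sum\<close> and
  \<open>smooth_on_bounded_linear\<close> apply.\<close>

lemma partial_q_eq:
  fixes G :: "real \<Rightarrow> real^'n \<Rightarrow> real^'p \<Rightarrow> real^'m"
  assumes "(\<lambda>(t, x, \<rho>). G t x \<rho>) differentiable (at (t, q, \<rho>))"
  shows "partial_q G t q \<rho> = (\<Sum>j\<in>UNIV. (\<chi> i k. if k = j then
    frechet_derivative (\<lambda>(t, x, \<rho>). G t x \<rho>) (at (t, q, \<rho>)) (0, axis j 1, 0) $ i else 0))"
proof -
  let ?H = "\<lambda>(t, x, \<rho>). G t x \<rho>"
  have "(?H has_derivative frechet_derivative ?H (at (t, q, \<rho>))) (at (t, q, \<rho>))"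
    using assms frechet_derivative_works by blast
  then have "(?H \<circ> (\<lambda>x. (t, x, \<rho>)) has_derivative
      frechet_derivative ?H (at (t, q, \<rho>)) \<circ> (\<lambda>h. (0, h, 0))) (at q)"
    by (intro diff_chain_at) (auto intro!: derivative_eq_intros)
  from fun_cong[OF frechet_derivative_at[OF this]]
  have "frechet_derivative (\<lambda>x. G t x \<rho>) (at q) h = frechet_derivative ?H (at (t, q, \<rho>)) (0, h, 0)" for h
    by (simp add: o_def)
  then show ?thesis
    unfolding partial_q_def jacobian_def matrix_def
    by (simp only: vec_eq_iff sum_component vec_lambda_beta if_distrib) (simp add: sum.delta)
qed

lemma smooth_on_partial_t:
  fixes G :: "real \<Rightarrow> real^'n \<Rightarrow> real^'p \<Rightarrow> 'b::real_normed_vector"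
  assumes "smooth_on (\<lambda>(t, x, \<rho>). G t x \<rho>) (UNIV \<times> UNIV \<times> U)" "open U"
  shows "smooth_on (\<lambda>(t, x, \<rho>). partial_t G t x \<rho>) (UNIV \<times> UNIV \<times> U)"
proof (rule smooth_on_cong)
  show "smooth_on (\<lambda>z. frechet_derivative (\<lambda>(t, x, \<rho>). G t x \<rho>) (at z) (1, 0, 0)) (UNIV \<times> UNIV \<times> U)"
    by (rule smooth_on_frechet_derivative[OF assms(1)])
  show "frechet_derivative (\<lambda>(t, x, \<rho>). G t x \<rho>) (at z) (1, 0, 0) = (\<lambda>(t, x, \<rho>). partial_t G t x \<rho>) z"
    if "z \<in> UNIV \<times> UNIV \<times> U" for z
    using partial_t_eq[OF smooth_on_imp_differentiable[OF assms(1)]] that by auto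
qed (intro open_Times open_UNIV assms)

lemma smooth_on_partial_q:
  fixes G :: "real \<Rightarrow> real^'n \<Rightarrow> real^'p \<Rightarrow> real^'m"
  assumes "smooth_on (\<lambda>(t, x, \<rho>). G t x \<rho>) (UNIV \<times> UNIV \<times> U)" "open U"
  shows "smooth_on (\<lambda>(t, x, \<rho>). partial_q G t x \<rho>) (UNIV \<times> UNIV \<times> U)"
proof (rule smooth_on_cong)
  show op: "open (UNIV \<times> UNIV \<times> U :: (real \<times> (real^'n) \<times> (real^'p)) set)"
    by (intro open_Times open_UNIV assms)
  have "bounded_linear (\<lambda>w :: real^'m. (\<chi> i k. if k = j then w $ i else 0) :: real^'n^'m)" for j
    unfolding linear_conv_bounded_linear[symmetric]
    by (rule linearI) (auto simp: vec_eq_iff)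
  from smooth_on_bounded_linear[OF op this smooth_on_frechet_derivative[OF assms(1)]]
  show "smooth_on (\<lambda>z. \<Sum>j\<in>UNIV. (\<chi> i k. if k = j then
      frechet_derivative (\<lambda>(t, x, \<rho>). G t x \<rho>) (at z) (0, axis j 1, 0) $ i else 0) :: real^'n^'m)
      (UNIV \<times> UNIV \<times> U)"
    by (intro smooth_on_sum op)
  show "(\<Sum>j\<in>UNIV. (\<chi> i k. if k = j then
      frechet_derivative (\<lambda>(t, x, \<rho>). G t x \<rho>) (at z) (0, axis j 1, 0) $ i else 0)) =
      (\<lambda>(t, x, \<rho>). partial_q G t x \<rho>) z"
    if "z \<in> UNIV \<times> UNIV \<times> U" for z
    using partial_q_eq[OF smooth_on_imp_differentiable[OF assms(1)]] that by auto
qed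

text \<open>The direction \<open>(1, y, 0)\<close> varies with the velocity, whereas smoothness is
  known only for derivatives in fixed directions. Linearity splits it into fixed directions with
  coefficients \<open>1\<close> and \<open>y $ j\<close>.\<close>

lemma lipschitz_near_total_dt:
  fixes G :: "real \<Rightarrow> real^'n \<Rightarrow> real^'p \<Rightarrow> 'b::real_normed_vector"
  assumes "smooth_on (\<lambda>(t, x, \<rho>). G t x \<rho>) (UNIV \<times> UNIV \<times> U)" "open U" "\<rho> \<in> U"
  shows "lipschitz_near (\<lambda>(t, x, y, \<rho>). total_dt G t x y \<rho>) (t, q, v, \<rho>)"
proof (rule lipschitz_near_cong)
  let ?D = "\<lambda>t x \<rho>. frechet_derivative (\<lambda>(t, x, \<rho>). G t x \<rho>) (at (t, x, \<rho>))"
  let ?S = "UNIV \<times> UNIV \<times> UNIV \<times> U :: (real \<times> (real^'n) \<times> (real^'n) \<times> (real^'p)) set"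
  have D: "total_dt G t x y \<rho> = ?D t x \<rho> (1, 0, 0) + (\<Sum>j\<in>UNIV. y $ j *\<^sub>R ?D t x \<rho> (0, axis j 1, 0))"
    if "\<rho> \<in> U" for t x y \<rho>
  proof -
    have diff: "(\<lambda>(t, x, \<rho>). G t x \<rho>) differentiable (at (t, x, \<rho>))"
      using smooth_on_imp_differentiable[OF assms(1)] that by simp
    then have lin: "linear (?D t x \<rho>)"
      using frechet_derivative_works has_derivative_linear by blast
    have snd: "linear (\<lambda>h :: real^'n. (0 :: real, h, 0 :: real^'p))"
      by (rule linearI) auto
    have "(0 :: real, y, 0 :: real^'p) = (0, \<Sum>j\<in>UNIV. y $ j *\<^sub>R axis j 1, 0)"
      using basis_expansion[of y] by (simp only: scalar_mult_eq_scaleR)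
    also have "\<dots> = (\<Sum>j\<in>UNIV. y $ j *\<^sub>R (0, axis j 1, 0))"
      using linear_sum[OF snd, of "\<lambda>j. y $ j *\<^sub>R axis j 1" UNIV]
      by (simp only: scaleR_Pair scaleR_zero_right)
    finally have y: "(0 :: real, y, 0 :: real^'p) = (\<Sum>j\<in>UNIV. y $ j *\<^sub>R (0, axis j 1, 0))" .
    have "(1, y, 0) = (1, 0, 0) + (\<Sum>j\<in>UNIV. y $ j *\<^sub>R (0 :: real, axis j 1, 0 :: real^'p))"
      by (simp only: add_Pair add_0_left add_0_right flip: y)
    then show ?thesis
      unfolding total_dt_eq[OF diff] by (simp only: linear_add[OF lin] linear_sum[OF lin] linear_scale[OF lin])
  qed
  have "\<forall>\<^sub>F z in nhds (t, q, v, \<rho>). z \<in> ?S"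
    using assms by (intro eventually_nhds_in_open open_Times open_UNIV) auto
  then show "\<forall>\<^sub>F z in nhds (t, q, v, \<rho>). (\<lambda>(t, x, y, \<rho>). ?D t x \<rho> (1, 0, 0) +
      (\<Sum>j\<in>UNIV. y $ j *\<^sub>R ?D t x \<rho> (0, axis j 1, 0))) z = (\<lambda>(t, x, y, \<rho>). total_dt G t x y \<rho>) z"
    by eventually_elim (auto simp: D)
  have bl: "bounded_linear (\<lambda>z :: real \<times> (real^'n) \<times> (real^'n) \<times> (real^'p).
      (fst z, fst (snd z), snd (snd (snd z))))"
    by (intro bounded_linear_intros)
  have nth: "bounded_linear (\<lambda>z :: real \<times> (real^'n) \<times> (real^'n) \<times> (real^'p). fst (snd (snd z)) $ j)" for j
    by (intro bounded_linear_compose[OF bounded_linear_vec_nth] bounded_linear_intros)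
  have "lipschitz_near (\<lambda>z. frechet_derivative (\<lambda>(t, x, \<rho>). G t x \<rho>) (at z) h) (t, q, \<rho>)" for h
    by (rule smooth_on_imp_lipschitz_near[OF smooth_on_frechet_derivative[OF assms(1)]])
      (use assms in \<open>auto intro!: open_Times\<close>)
  from lipschitz_near_compose[OF lipschitz_near_bounded_linear[OF bl, of "(t, q, v, \<rho>)"], simplified, OF this]
  show "lipschitz_near (\<lambda>(t, x, y, \<rho>). ?D t x \<rho> (1, 0, 0) +
      (\<Sum>j\<in>UNIV. y $ j *\<^sub>R ?D t x \<rho> (0, axis j 1, 0))) (t, q, v, \<rho>)"
    unfolding case_prod_unfold
    by (intro lipschitz_near_add lipschitz_near_sum lipschitz_near_bounded_linear[OF nth]
        lipschitz_near_bounded_bilinear[OF bounded_bilinear_scaleR]) (simp_all add: case_prod_unfold)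
qed

text \<open>The terms \<open>total_dt (partial_q \<Phi>)\<close> and
  \<open>total_dt (partial_t \<Phi>)\<close> contain second derivatives of the constraint; they are
  covered because the partial derivatives of a smooth map are smooth again. All else is sums,
  products and one inverse.\<close>

lemma lipschitz_near_f_eom:
  fixes \<Phi> :: "real \<Rightarrow> real^'n \<Rightarrow> real^'p \<Rightarrow> real^'m"
  assumes U: "open U" "\<rho> \<in> U"
    and M: "smooth_on (\<lambda>(t, x, \<rho>). M t x \<rho>) (UNIV \<times> UNIV \<times> U)"
    and F: "smooth_on (\<lambda>(t, x, y, \<rho>). F t x y \<rho>) (UNIV \<times> UNIV \<times> UNIV \<times> U)"
    and \<Phi>: "smooth_on (\<lambda>(t, x, \<rho>). \<Phi> t x \<rho>) (UNIV \<times> UNIV \<times> U)"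
    and inv: "invertible (Mbar M \<alpha> \<Phi> t q \<rho>)"
  shows "lipschitz_near (\<lambda>(t, x, y, \<rho>). f_eom M F \<alpha> \<xi> \<omega> \<Phi> t x y \<rho>) (t, q, v, \<rho>)"
proof -
  let ?z = "(t, q, v, \<rho>)"
  have bl: "bounded_linear (\<lambda>z :: real \<times> (real^'n) \<times> (real^'n) \<times> (real^'p).
      (fst z, fst (snd z), snd (snd (snd z))))"
    by (intro bounded_linear_intros)
  have base: "lipschitz_near (\<lambda>(t, x, y, \<rho>). G t x \<rho>) ?z"
    if "smooth_on (\<lambda>(t, x, \<rho>). G t x \<rho>) (UNIV \<times> UNIV \<times> U)"
    for G :: "real \<Rightarrow> real^'n \<Rightarrow> real^'p \<Rightarrow> 'b::real_normed_vector"
  proof -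
    have "lipschitz_near (\<lambda>(t, x, \<rho>). G t x \<rho>) (t, q, \<rho>)"
      by (rule smooth_on_imp_lipschitz_near[OF that]) (use U in \<open>auto intro!: open_Times\<close>)
    from lipschitz_near_compose[OF lipschitz_near_bounded_linear[OF bl, of ?z], simplified, OF this]
    show ?thesis by (simp add: case_prod_unfold)
  qed
  have total: "lipschitz_near (\<lambda>(t, x, y, \<rho>). total_dt G t x y \<rho>) ?z"
    if "smooth_on (\<lambda>(t, x, \<rho>). G t x \<rho>) (UNIV \<times> UNIV \<times> U)"
    for G :: "real \<Rightarrow> real^'n \<Rightarrow> real^'p \<Rightarrow> 'b::real_normed_vector"
    by (rule lipschitz_near_total_dt[OF that U])
  note q = smooth_on_partial_q[OF \<Phi> U(1)]
  note lip = base[OF M, unfolded case_prod_unfold] base[OF q, unfolded case_prod_unfold]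
    base[OF \<Phi>, unfolded case_prod_unfold] total[OF \<Phi>, unfolded case_prod_unfold]
    total[OF q, unfolded case_prod_unfold]
    total[OF smooth_on_partial_t[OF \<Phi> U(1)], unfolded case_prod_unfold]
  have F: "lipschitz_near (\<lambda>z. F (fst z) (fst (snd z)) (fst (snd (snd z))) (snd (snd (snd z)))) ?z"
    using smooth_on_imp_lipschitz_near[OF F, of ?z] U
    by (simp add: case_prod_unfold open_Times)
  have y: "lipschitz_near (\<lambda>z :: real \<times> (real^'n) \<times> (real^'n) \<times> (real^'p). fst (snd (snd z))) ?z"
    by (intro lipschitz_near_bounded_linear bounded_linear_intros)
  show ?thesis
    unfolding f_eom_def case_prod_unfold
  proof (rule lipschitz_near_matrix_inv_mult)
    show "lipschitz_near (\<lambda>z. Mbar M \<alpha> \<Phi> (fst z) (fst (snd z)) (snd (snd (snd z)))) ?z"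
      unfolding Mbar_def
      by (intro lipschitz_near_add lipschitz_near_bounded_bilinear[OF bounded_bilinear_matrix_matrix_mult]
          lipschitz_near_linear_compose[OF bounded_linear_transpose] lipschitz_near_const lip)
    show "lipschitz_near (\<lambda>z. Fbar F \<alpha> \<xi> \<omega> \<Phi> (fst z) (fst (snd z)) (fst (snd (snd z)))
        (snd (snd (snd z)))) ?z"
      unfolding Fbar_def
      by (intro lipschitz_near_add lipschitz_near_diff
          lipschitz_near_bounded_bilinear[OF bounded_bilinear_matrix_matrix_mult]
          lipschitz_near_bounded_bilinear[OF bounded_bilinear_matrix_vector_mult]
          lipschitz_near_linear_compose[OF bounded_linear_transpose]
          lipschitz_near_linear_compose[OF bounded_linear_scaleR_right] lipschitz_near_const lip F y)
  qed (use inv in simp)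
qed

subsection \<open>Gronwall estimates\<close>

text \<open>Otherwise there are pairs at distance below \<open>1 / (n + 1)\<close> that violate the
  constant \<open>n\<close>. Along a subsequence both members converge to one point of
  \<open>K\<close>, where a fixed Lipschitz constant contradicts the violation. Only
  \<open>z\<close> has to lie in \<open>K\<close>, so the estimate holds on a tube around
  \<open>K\<close>.\<close>

lemma lipschitz_near_compact:
  assumes "compact K" "\<And>z. z \<in> K \<Longrightarrow> lipschitz_near g z"
  obtains \<delta> L where "\<delta> > 0" "L \<ge> 0"
    "\<And>z z'. z \<in> K \<Longrightarrow> dist z' z < \<delta> \<Longrightarrow> dist (g z') (g z) \<le> L * dist z' z"
proof (rule ccontr)
  assume "\<not> thesis"
  with that have *: "\<exists>z z'. z \<in> K \<and> dist z' z < \<delta> \<and> dist (g z') (g z) > L * dist z' z"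
    if "\<delta> > 0" "L \<ge> 0" for \<delta> L
    using \<open>\<delta> > 0\<close> \<open>L \<ge> 0\<close> by (meson not_le)
  have "\<forall>n. \<exists>z z'. z \<in> K \<and> dist z' z < 1 / real (Suc n) \<and> dist (g z') (g z) > real n * dist z' z"
    using * by simp
  then obtain z z' where z: "\<And>n. z n \<in> K" "\<And>n. dist (z' n) (z n) < 1 / real (Suc n)"
      "\<And>n. dist (g (z' n)) (g (z n)) > real n * dist (z' n) (z n)"
    by metis
  obtain l r where l: "l \<in> K" "strict_mono (r :: nat \<Rightarrow> nat)" "(z \<circ> r) \<longlonglongrightarrow> l"
    using assms(1) z(1) unfolding compact_def by metis
  have "(\<lambda>n. dist (z' n) (z n)) \<longlonglongrightarrow> 0"
    by (rule Lim_null_comparison[OF _ lim_1_over_n[THEN LIMSEQ_Suc]]) (use z(2) in \<open>auto intro!: always_eventually less_imp_le\<close>)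
  then have d0: "(\<lambda>n. dist (z' (r n)) (z (r n))) \<longlonglongrightarrow> 0"
    using LIMSEQ_subseq_LIMSEQ[OF _ l(2)] by (force simp: o_def)
  obtain \<epsilon> L where e: "\<epsilon> > 0" "L-lipschitz_on (ball l \<epsilon>) g"
    using assms(2)[OF l(1)] unfolding lipschitz_near_def by blast
  have "\<forall>\<^sub>F n in sequentially. dist (z (r n)) l < \<epsilon> / 2"
    using tendstoD[OF l(3), of "\<epsilon> / 2"] e(1) by (simp add: o_def)
  moreover have "\<forall>\<^sub>F n in sequentially. dist (z' (r n)) (z (r n)) < \<epsilon> / 2"
    using order_tendstoD(2)[OF d0, of "\<epsilon> / 2"] e(1) by simp
  moreover have "\<forall>\<^sub>F n in sequentially. L \<le> real n"
    by (meson eventually_sequentiallyI real_nat_ceiling_ge of_nat_le_iff order_trans)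
  ultimately have "\<forall>\<^sub>F n :: nat in sequentially. False"
  proof eventually_elim
    case (elim n)
    have "dist (z' (r n)) l < \<epsilon>"
      using dist_triangle[of "z' (r n)" l "z (r n)"] elim by linarith
    then have "dist (g (z' (r n))) (g (z (r n))) \<le> L * dist (z' (r n)) (z (r n))"
      using elim e(1) by (intro lipschitz_onD[OF e(2)]) (auto simp: dist_commute)
    also have "\<dots> \<le> real (r n) * dist (z' (r n)) (z (r n))"
      using elim(3) seq_suble[OF l(2), of n] by (intro mult_right_mono) auto
    finally show False using z(3)[of "r n"] by simp
  qed
  then show False by simp
qed

text \<open>The differential inequality is only available while \<open>\<phi>\<close> stays below the level \<open>r\<close>; the
  bound it yields keeps \<open>\<phi>\<close> from ever reaching that level.\<close>

lemma gronwall_below_level: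
  fixes \<phi> :: "real \<Rightarrow> real"
  assumes cont: "continuous_on {a..b} \<phi>"
    and deriv: "\<And>t. a < t \<Longrightarrow> t < b \<Longrightarrow> \<phi> t < r \<Longrightarrow> \<exists>d. (\<phi> has_real_derivative d) (at t) \<and> d \<le> K * \<phi> t"
    and "K \<ge> 0" "\<phi> a \<ge> 0" and level: "\<phi> a * exp (K * (b - a)) < r"
    and t: "t \<in> {a..b}"
  shows "\<phi> t \<le> \<phi> a * exp (K * (b - a))"
proof -
  have below: "\<phi> s \<le> \<phi> a * exp (K * (b - a))" if s: "a \<le> s" "s \<le> b" "\<And>u. a < u \<Longrightarrow> u < s \<Longrightarrow> \<phi> u < r" for s
  proof -
    \<comment> \<open>With the integrating factor \<open>exp (- K * (u - a))\<close> the
      differential inequality says that the product is nonincreasing.\<close>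
    have "\<phi> a * exp (- K * (a - a)) \<ge> \<phi> s * exp (- K * (s - a))"
    proof (rule DERIV_nonpos_imp_decreasing_open[OF s(1)])
      show "continuous_on {a..s} (\<lambda>u. \<phi> u * exp (- K * (u - a)))"
        using s by (intro continuous_intros continuous_on_subset[OF cont]) auto
      fix u assume u: "a < u" "u < s"
      then obtain d where d: "(\<phi> has_real_derivative d) (at u)" "d \<le> K * \<phi> u"
        using deriv s by force
      have "((\<lambda>u. \<phi> u * exp (- K * (u - a))) has_real_derivative
          (d - K * \<phi> u) * exp (- K * (u - a))) (at u)"
        using d(1) by (auto intro!: derivative_eq_intros simp: algebra_simps)
      moreover have "(d - K * \<phi> u) * exp (- K * (u - a)) \<le> 0"
        using d(2) by (simp add: mult_le_0_iff)
      ultimately show "\<exists>y. ((\<lambda>u. \<phi> u * exp (- K * (u - a))) has_real_derivative y) (at u) \<and> y \<le> 0"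
        by blast
    qed
    then have "\<phi> s * exp (- (K * (s - a))) \<le> \<phi> a" by simp
    then have "\<phi> s \<le> \<phi> a * exp (K * (s - a))"
      by (simp only: exp_minus divide_inverse[symmetric] pos_divide_le_eq[OF exp_gt_zero])
    also have "\<dots> \<le> \<phi> a * exp (K * (b - a))"
      using s assms by (auto intro!: mult_left_mono)
    finally show ?thesis .
  qed
  have "\<phi> s < r" if "s \<in> {a..b}" for s
  proof (rule ccontr)
    assume "\<not> \<phi> s < r"
    \<comment> \<open>\<open>Inf S\<close> is the first time at which the level is reached. Before
      it \<open>\<phi>\<close> is below \<open>r\<close>, so \<open>below\<close> holds at that very
      time and contradicts \<open>level\<close>.\<close>
    define S where "S = {a..b} \<inter> \<phi> -` {r..}"
    have "closed S"
      unfolding S_def by (intro continuous_closed_preimage cont) auto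
    moreover have "s \<in> S" using that \<open>\<not> \<phi> s < r\<close> by (simp add: S_def)
    moreover have bdd: "bdd_below S" by (auto simp: S_def intro: bdd_belowI[of _ a])
    ultimately have "Inf S \<in> S" using closed_contains_Inf[of S] by blast
    then have S: "a \<le> Inf S" "Inf S \<le> b" "r \<le> \<phi> (Inf S)" by (auto simp: S_def)
    have "\<phi> u < r" if "a < u" "u < Inf S" for u
    proof (rule ccontr)
      assume "\<not> \<phi> u < r"
      then have "u \<in> S" using that S by (simp add: S_def)
      then show False using cInf_lower[OF _ bdd] that by force
    qed
    with below S level show False by force
  qed
  with below t show ?thesis by auto
qed

text \<open>Gronwall is applied to the squared norm, which is differentiable also where the
  difference vanishes. Adding \<open>\<eta>\<^sup>2\<close> absorbs the inhomogeneous term and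
  leaves the homogeneous inequality with factor \<open>4 * L\<close>; at time 0 it gives the factor
  \<open>C\<^sup>2 + 1\<close>. The exponent carries no time because the interval has length
  1.\<close>

lemma ode_difference_bound:
  fixes x y :: "real \<Rightarrow> 'a::real_inner"
  assumes cont: "continuous_on {0..1} x" "continuous_on {0..1} y"
    and deriv: "\<And>u. u \<in> {0<..<1} \<Longrightarrow> (x has_vector_derivative x' u) (at u)"
      "\<And>u. u \<in> {0<..<1} \<Longrightarrow> (y has_vector_derivative y' u) (at u)"
    and bound: "\<And>u. u \<in> {0<..<1} \<Longrightarrow> norm (y u - x u) < \<delta> \<Longrightarrow>
      norm (y' u - x' u) \<le> L * (norm (y u - x u) + \<eta>)"
    and "L \<ge> 0" "\<eta> \<ge> 0" "\<delta> > 0" "C \<ge> 0"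
    and start: "norm (y 0 - x 0) \<le> C * \<eta>" and small: "sqrt ((C\<^sup>2 + 1) * exp (4 * L)) * \<eta> < \<delta>"
    and u: "u \<in> {0..1}"
  shows "norm (y u - x u) \<le> sqrt ((C\<^sup>2 + 1) * exp (4 * L)) * \<eta>"
proof -
  define \<phi> where "\<phi> = (\<lambda>u. (norm (y u - x u))\<^sup>2 + \<eta>\<^sup>2)"
  define E where "E = sqrt ((C\<^sup>2 + 1) * exp (4 * L)) * \<eta>"
  have "(norm (y 0 - x 0))\<^sup>2 \<le> (C * \<eta>)\<^sup>2"
    using start by (intro power_mono) auto
  then have "\<phi> 0 \<le> (C\<^sup>2 + 1) * \<eta>\<^sup>2"
    by (simp add: \<phi>_def power_mult_distrib algebra_simps)
  moreover have E2: "E\<^sup>2 = (C\<^sup>2 + 1) * \<eta>\<^sup>2 * exp (4 * L)"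
    by (simp add: E_def power_mult_distrib real_sqrt_pow2 add_nonneg_nonneg mult.commute mult.left_commute)
  ultimately have 0: "\<phi> 0 * exp (4 * L * (1 - 0)) \<le> E\<^sup>2"
    by simp
  have "E \<ge> 0" using \<open>\<eta> \<ge> 0\<close> by (simp add: E_def)
  then have "E\<^sup>2 < \<delta>\<^sup>2" using small by (intro power_strict_mono) (auto simp: E_def)
  have "\<phi> u \<le> \<phi> 0 * exp (4 * L * (1 - 0))"
  proof (rule gronwall_below_level[OF _ _ _ _ _ u])
    show "continuous_on {0..1} \<phi>"
      unfolding \<phi>_def by (intro continuous_intros cont)
    \<comment> \<open>The level is \<open>\<delta>\<^sup>2\<close>: below it the two curves are
      closer than \<open>\<delta>\<close>, which is where \<open>bound\<close> may be used.\<close>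
    show "\<phi> 0 * exp (4 * L * (1 - 0)) < \<delta>\<^sup>2" using 0 \<open>E\<^sup>2 < \<delta>\<^sup>2\<close> by linarith
    fix t :: real assume t: "0 < t" "t < 1" "\<phi> t < \<delta>\<^sup>2"
    let ?d = "norm (y t - x t)"
    have "?d\<^sup>2 < \<delta>\<^sup>2" using t zero_le_power2[of \<eta>] unfolding \<phi>_def by linarith
    then have "?d < \<delta>" using \<open>\<delta> > 0\<close> by (auto intro: power2_less_imp_less)
    then have b: "norm (y' t - x' t) \<le> L * (?d + \<eta>)" using bound t by simp
    have D: "((\<lambda>u. y u - x u) has_derivative (\<lambda>h. h *\<^sub>R (y' t - x' t))) (at t)"
      using has_vector_derivative_diff[OF deriv(2,1)] t by (simp add: has_vector_derivative_def)
    have "((\<lambda>u. (y u - x u) \<bullet> (y u - x u) + \<eta>\<^sup>2) has_derivative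
        (\<lambda>h. h * (2 * ((y t - x t) \<bullet> (y' t - x' t))))) (at t)"
      by (rule has_derivative_eq_rhs[OF has_derivative_add_const[OF has_derivative_inner[OF D D]]])
        (simp add: fun_eq_iff inner_commute algebra_simps)
    then have "(\<phi> has_real_derivative 2 * ((y t - x t) \<bullet> (y' t - x' t))) (at t)"
      unfolding \<phi>_def has_field_derivative_def power2_norm_eq_inner
      by (simp only: mult.commute[of _ "2 * _"])
    moreover have "2 * ((y t - x t) \<bullet> (y' t - x' t)) \<le> 4 * L * \<phi> t"
    proof -
      have "(y t - x t) \<bullet> (y' t - x' t) \<le> ?d * norm (y' t - x' t)"
        by (rule norm_cauchy_schwarz)
      also have "\<dots> \<le> ?d * (L * (?d + \<eta>))"
        using b by (intro mult_left_mono) auto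
      also have "\<dots> = L * (?d\<^sup>2 + ?d * \<eta>)"
        by (simp add: algebra_simps power2_eq_square)
      also have "\<dots> \<le> L * (2 * \<phi> t)"
      proof (intro mult_left_mono)
        have "0 \<le> (?d - \<eta> / 2)\<^sup>2 + 7 / 4 * \<eta>\<^sup>2" by simp
        also have "\<dots> = 2 * \<phi> t - (?d\<^sup>2 + ?d * \<eta>)"
          by (simp add: \<phi>_def power2_eq_square field_simps)
        finally show "?d\<^sup>2 + ?d * \<eta> \<le> 2 * \<phi> t" by simp
      qed fact
      finally show ?thesis by simp
    qed
    ultimately show "\<exists>d. (\<phi> has_real_derivative d) (at t) \<and> d \<le> 4 * L * \<phi> t" by blast
  qed (use \<open>L \<ge> 0\<close> in \<open>simp_all add: \<phi>_def\<close>)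
  then have "(norm (y u - x u))\<^sup>2 \<le> E\<^sup>2"
    using 0 zero_le_power2[of \<eta>] unfolding \<phi>_def by linarith
  then show ?thesis
    using \<open>E \<ge> 0\<close> unfolding E_def by (rule power2_le_imp_le)
qed

lemma differentiable_imp_locally_bounded:
  fixes f :: "'a::real_normed_vector \<Rightarrow> 'b::real_normed_vector"
  assumes "f differentiable (at x)"
  obtains C where "C \<ge> 0" "\<forall>\<^sub>F y in nhds x. norm (f y - f x) \<le> C * norm (y - x)"
proof -
  obtain f' where f': "(f has_derivative f') (at x)"
    using assms by (auto simp: differentiable_def)
  obtain K where K: "K \<ge> 0" "\<And>h. norm (f' h) \<le> norm h * K"
    using bounded_linear.nonneg_bounded[OF has_derivative_bounded_linear[OF f']] by blast
  obtain d where d: "d > 0" "\<And>y. norm (y - x) < d \<Longrightarrow> norm (f y - f x - f' (y - x)) \<le> 1 * norm (y - x)"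
    using f' unfolding has_derivative_at_alt by (metis zero_less_one)
  show ?thesis
  \<comment> \<open>\<open>K\<close> bounds the derivative, and the remainder is at most
    \<open>1 * norm (y - x)\<close> near \<open>x\<close>.\<close>
  proof (rule that[of "K + 1"])
    show "\<forall>\<^sub>F y in nhds x. norm (f y - f x) \<le> (K + 1) * norm (y - x)"
      unfolding eventually_nhds_metric
    proof (intro exI[of _ d] conjI allI impI d)
      fix y assume "dist y x < d"
      then have "norm (f y - f x - f' (y - x)) \<le> norm (y - x)"
        using d(2)[of y] by (simp add: dist_norm)
      then show "norm (f y - f x) \<le> (K + 1) * norm (y - x)"
        using K(2)[of "y - x"] norm_triangle_sub[of "f y - f x" "f' (y - x)"] by (simp add: algebra_simps)
    qed
  qed (use K in simp)
qed

subsection \<open>Motion up to the event\<close>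

text \<open>One of the two smooth phases of the motion: \<open>c\<close> is the fixed end of the time window and
  \<open>e \<sigma>\<close> the event time, which lies after \<open>c\<close> for the phase before the event and before \<open>c\<close> for
  the phase after it.\<close>

locale phase =
  fixes X :: "real \<Rightarrow> 'r::real_normed_vector \<Rightarrow> 'a::real_inner"
    and g :: "real \<times> 'a \<times> 'r \<Rightarrow> 'a"
    and c :: real and e :: "'r \<Rightarrow> real" and \<rho> :: 'r
  assumes e_diff: "e differentiable (at \<rho>)"
    and c_neq: "e \<rho> \<noteq> c"
    and cont: "\<forall>\<^sub>F \<sigma> in nhds \<rho>. continuous_on (closed_segment c (e \<sigma>)) (\<lambda>t. X t \<sigma>)"
    and ode: "\<forall>\<^sub>F \<sigma> in nhds \<rho>. \<forall>t\<in>open_segment c (e \<sigma>).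
      ((\<lambda>s. X s \<sigma>) has_vector_derivative g (t, X t \<sigma>, \<sigma>)) (at t)"
    and lip: "\<And>t. t \<in> closed_segment c (e \<rho>) \<Longrightarrow> lipschitz_near g (t, X t \<rho>, \<rho>)"
begin

text \<open>The graph of the motion over the closed segment is compact, so a single Lipschitz
  constant serves along all of it, the event included.\<close>

lemma tube:
  obtains \<delta> L where "\<delta> > 0" "L \<ge> 0"
    "\<And>t z'. t \<in> closed_segment c (e \<rho>) \<Longrightarrow> dist z' (t, X t \<rho>, \<rho>) < \<delta> \<Longrightarrow>
      norm (g z' - g (t, X t \<rho>, \<rho>)) \<le> L * dist z' (t, X t \<rho>, \<rho>)"
proof -
  let ?K = "(\<lambda>t. (t, X t \<rho>, \<rho>)) ` closed_segment c (e \<rho>)"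
  have "continuous_on (closed_segment c (e \<rho>)) (\<lambda>t. (t, X t \<rho>, \<rho>))"
    using eventually_nhds_x_imp_x[OF cont] by (intro continuous_intros)
  then have "compact ?K" by (intro compact_continuous_image) auto
  then obtain \<delta> L where "\<delta> > 0" "L \<ge> 0"
    "\<And>z z'. z \<in> ?K \<Longrightarrow> dist z' z < \<delta> \<Longrightarrow> dist (g z') (g z) \<le> L * dist z' z"
    by (rule lipschitz_near_compact[of _ g]) (use lip in blast)+
  then show ?thesis using that[of \<delta> L] by (simp add: dist_norm)
qed

lemma g_bounded:
  obtains B where "B \<ge> 0" "\<And>t. t \<in> closed_segment c (e \<rho>) \<Longrightarrow> norm (g (t, X t \<rho>, \<rho>)) \<le> B"
proof -
  have "continuous_on (closed_segment c (e \<rho>)) (\<lambda>t. (t, X t \<rho>, \<rho>))"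
    using eventually_nhds_x_imp_x[OF cont] by (intro continuous_intros)
  moreover have "continuous_on ((\<lambda>t. (t, X t \<rho>, \<rho>)) ` closed_segment c (e \<rho>)) g"
    using lipschitz_near_imp_isCont[OF lip] by (intro continuous_at_imp_continuous_on) auto
  ultimately have "continuous_on (closed_segment c (e \<rho>)) (\<lambda>t. g (t, X t \<rho>, \<rho>))"
    using continuous_on_compose[of _ "\<lambda>t. (t, X t \<rho>, \<rho>)" g] by (simp add: o_def)
  then have "bounded ((\<lambda>t. g (t, X t \<rho>, \<rho>)) ` closed_segment c (e \<rho>))"
    by (intro compact_imp_bounded compact_continuous_image) auto
  then obtain B where "B > 0" "\<And>t. t \<in> closed_segment c (e \<rho>) \<Longrightarrow> norm (g (t, X t \<rho>, \<rho>)) \<le> B"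
    unfolding bounded_pos by blast
  then show ?thesis using that[of B] by simp
qed

text \<open>Rescaling time maps every phase onto \<open>[0, 1]\<close>, so that the event time turns into one more
  parameter and motions with different event times can be compared up to the event.\<close>

definition resc :: "'r \<Rightarrow> real \<Rightarrow> real" where
  "resc \<sigma> u = c + u * (e \<sigma> - c)"

lemma resc_segment:
  "closed_segment c (e \<sigma>) = resc \<sigma> ` {0..1}"
  "c \<noteq> e \<sigma> \<Longrightarrow> open_segment c (e \<sigma>) = resc \<sigma> ` {0<..<1}"
  unfolding closed_segment_image_interval open_segment_image_interval resc_def
  by (auto simp: algebra_simps intro!: image_eqI)

lemma resc_derivative:
  assumes "\<forall>t\<in>open_segment c (e \<sigma>). ((\<lambda>s. X s \<sigma>) has_vector_derivative g (t, X t \<sigma>, \<sigma>)) (at t)"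
    and "c \<noteq> e \<sigma>" "u \<in> {0<..<1}"
  shows "((\<lambda>u. X (resc \<sigma> u) \<sigma>) has_vector_derivative
    (e \<sigma> - c) *\<^sub>R g (resc \<sigma> u, X (resc \<sigma> u) \<sigma>, \<sigma>)) (at u)"
proof -
  have "(resc \<sigma> has_vector_derivative (e \<sigma> - c)) (at u)"
    unfolding resc_def[abs_def] by (auto intro!: derivative_eq_intros)
  moreover have "((\<lambda>s. X s \<sigma>) has_vector_derivative g (resc \<sigma> u, X (resc \<sigma> u) \<sigma>, \<sigma>)) (at (resc \<sigma> u))"
    using assms resc_segment(2) by blast
  ultimately show ?thesis
    using vector_diff_chain_at by (fastforce simp: o_def)
qed

lemma resc_continuous:
  assumes "continuous_on (closed_segment c (e \<sigma>)) (\<lambda>t. X t \<sigma>)"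
  shows "continuous_on {0..1} (\<lambda>u. X (resc \<sigma> u) \<sigma>)"
proof (rule continuous_on_compose2[OF assms])
  show "continuous_on {0..1} (resc \<sigma>)"
    unfolding resc_def[abs_def] by (intro continuous_intros)
qed (simp add: resc_segment(1))

lemma e_neq: "\<forall>\<^sub>F \<sigma> in nhds \<rho>. c \<noteq> e \<sigma>"
proof -
  have "(e \<longlongrightarrow> e \<rho>) (nhds \<rho>)"
    using differentiable_imp_continuous_within[OF e_diff]
    by (simp add: continuous_within tendsto_at_iff_tendsto_nhds)
  from tendsto_imp_eventually_ne[OF this c_neq] show ?thesis
    by (rule eventually_mono) auto
qed

lemma dist_Pair3_le: "dist (t', x', \<sigma>) (t, x, \<rho>) \<le> \<bar>t' - t\<bar> + norm (x' - x) + norm (\<sigma> - \<rho>)"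
  for t t' :: real and x x' :: 'a and \<sigma> :: 'r
  using norm_Pair_le[of "t' - t" "(x' - x, \<sigma> - \<rho>)"] norm_Pair_le[of "x' - x" "\<sigma> - \<rho>"]
  by (simp add: dist_norm)

lemma eventually_norm_less: "r > 0 \<Longrightarrow> \<forall>\<^sub>F \<sigma> in nhds \<rho>. norm (\<sigma> - \<rho>) < r"
  by (auto simp: eventually_nhds_metric dist_norm)

text \<open>\<open>i\<close> marks the end of the rescaled interval at which the state is already
  controlled: 0 is the end of the time window, 1 is the event. The first case serves the phase
  before the event, the second the phase after it.\<close>

lemma dependence_rescaled:
  assumes i: "i = 0 \<or> i = 1"
    and start: "\<forall>\<^sub>F \<sigma> in nhds \<rho>. norm (X (resc \<sigma> i) \<sigma> - X (resc \<rho> i) \<rho>) \<le> C * norm (\<sigma> - \<rho>)"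
    and "C \<ge> 0"
  obtains D where "D \<ge> 0" "\<forall>\<^sub>F \<sigma> in nhds \<rho>. \<forall>u\<in>{0..1}.
    norm (X (resc \<sigma> u) \<sigma> - X (resc \<rho> u) \<rho>) \<le> D * norm (\<sigma> - \<rho>)"
proof -
  obtain \<delta> L where \<delta>: "\<delta> > 0" "L \<ge> 0"
    and tube: "\<And>t z'. t \<in> closed_segment c (e \<rho>) \<Longrightarrow> dist z' (t, X t \<rho>, \<rho>) < \<delta> \<Longrightarrow>
      norm (g z' - g (t, X t \<rho>, \<rho>)) \<le> L * dist z' (t, X t \<rho>, \<rho>)"
    by (rule tube) blast
  obtain B where B: "B \<ge> 0" "\<And>t. t \<in> closed_segment c (e \<rho>) \<Longrightarrow> norm (g (t, X t \<rho>, \<rho>)) \<le> B"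
    by (rule g_bounded) blast
  obtain Ce where Ce: "Ce \<ge> 0" "\<forall>\<^sub>F \<sigma> in nhds \<rho>. norm (e \<sigma> - e \<rho>) \<le> Ce * norm (\<sigma> - \<rho>)"
    by (rule differentiable_imp_locally_bounded[OF e_diff]) blast
  \<comment> \<open>\<open>R\<close> bounds the scaling factor
    \<open>\<bar>e \<sigma> - c\<bar>\<close> once \<open>norm (\<sigma> - \<rho>) < 1\<close>. In
    \<open>M\<close>, the first summand collects the deviations in state, time and parameter, the
    second the change of the scaling factor times the speed bound \<open>B\<close>. \<open>D\<close>
    is the constant of \<open>ode_difference_bound\<close>.\<close>
  define R where "R = \<bar>e \<rho> - c\<bar> + Ce"
  define M where "M = R * L * (Ce + 1) + Ce * B"
  define D where "D = sqrt ((C\<^sup>2 + 1) * exp (4 * M))"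
  have R: "R \<ge> 0" and M: "M \<ge> 0" and D: "D \<ge> 0"
    using Ce \<delta> B by (auto simp: R_def M_def D_def)
  have MRL: "R * L \<le> M"
    using R \<delta> Ce B mult_nonneg_nonneg[of "R * L" Ce] by (simp add: M_def algebra_simps)
  \<comment> \<open>Half of the tube radius is reserved for the shift of time and parameter, the
    other half for the state, which \<open>D * \<eta>\<close> must not exceed.\<close>
  have "\<forall>\<^sub>F \<sigma> in nhds \<rho>. norm (\<sigma> - \<rho>) < min 1 (\<delta> / 2 / (Ce + 1 + D))"
    using Ce \<delta> D by (intro eventually_norm_less) auto
  then have "\<forall>\<^sub>F \<sigma> in nhds \<rho>. \<forall>u\<in>{0..1}.
      norm (X (resc \<sigma> u) \<sigma> - X (resc \<rho> u) \<rho>) \<le> D * norm (\<sigma> - \<rho>)"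
    using cont ode e_neq Ce(2) start
  proof eventually_elim
    case (elim \<sigma>)
    define \<eta> where "\<eta> = norm (\<sigma> - \<rho>)"
    have \<eta>: "\<eta> \<ge> 0" "\<eta> < 1" "\<eta> < \<delta> / 2 / (Ce + 1 + D)"
      using elim(1) by (simp_all add: \<eta>_def)
    have "(Ce + 1) * \<eta> + D * \<eta> < \<delta> / 2"
      using \<eta>(3) Ce D by (simp add: pos_less_divide_eq algebra_simps)
    moreover have "0 \<le> (Ce + 1) * \<eta>" "0 \<le> D * \<eta>" using Ce D \<eta> by simp_all
    ultimately have small: "(Ce + 1) * \<eta> < \<delta> / 2" "D * \<eta> < \<delta> / 2" by linarith+
    have e\<sigma>: "\<bar>e \<sigma> - e \<rho>\<bar> \<le> Ce * \<eta>" using elim(5) by (simp add: \<eta>_def)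
    also have "\<dots> \<le> Ce" using \<eta> Ce by (simp add: mult_left_le)
    finally have eR: "\<bar>e \<sigma> - c\<bar> \<le> R" by (simp add: R_def)
    define x y where "x = (\<lambda>u. X (resc \<rho> u) \<rho>)" and "y = (\<lambda>u. X (resc \<sigma> u) \<sigma>)"
    define x' y' where "x' = (\<lambda>u. (e \<rho> - c) *\<^sub>R g (resc \<rho> u, x u, \<rho>))"
      and "y' = (\<lambda>u. (e \<sigma> - c) *\<^sub>R g (resc \<sigma> u, y u, \<sigma>))"
    have cts: "continuous_on {0..1} x" "continuous_on {0..1} y"
      unfolding x_def y_def using resc_continuous eventually_nhds_x_imp_x[OF cont] elim(2) by blast+
    have der: "(x has_vector_derivative x' u) (at u)" "(y has_vector_derivative y' u) (at u)"
      if "u \<in> {0<..<1}" for u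
      unfolding x_def y_def x'_def y'_def
      using resc_derivative eventually_nhds_x_imp_x[OF ode] eventually_nhds_x_imp_x[OF e_neq] elim(3,4) that
      by blast+
    have bound: "norm (y' u - x' u) \<le> M * (norm (y u - x u) + \<eta>)"
      if u: "u \<in> {0<..<1}" "norm (y u - x u) < \<delta> / 2" for u
    proof -
      let ?z = "(resc \<rho> u, x u, \<rho>)" and ?z' = "(resc \<sigma> u, y u, \<sigma>)"
      have seg: "resc \<rho> u \<in> closed_segment c (e \<rho>)" using u resc_segment(1) by auto
      have "resc \<sigma> u - resc \<rho> u = u * (e \<sigma> - e \<rho>)" by (simp add: resc_def algebra_simps)
      then have "\<bar>resc \<sigma> u - resc \<rho> u\<bar> \<le> \<bar>e \<sigma> - e \<rho>\<bar>"
        using u by (simp add: abs_mult mult_left_le_one_le)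
      with dist_Pair3_le[of "resc \<sigma> u" "y u" \<sigma> "resc \<rho> u" "x u"] e\<sigma>
      have dz: "dist ?z' ?z \<le> norm (y u - x u) + (Ce + 1) * \<eta>"
        by (simp add: \<eta>_def algebra_simps)
      then have "dist ?z' ?z < \<delta>" using u small by linarith
      then have "norm (g ?z' - g ?z) \<le> L * dist ?z' ?z"
        using tube[OF seg] by (simp add: x_def)
      also have "\<dots> \<le> L * (norm (y u - x u) + (Ce + 1) * \<eta>)"
        using dz \<delta> by (intro mult_left_mono)
      finally have 1: "norm (g ?z' - g ?z) \<le> L * (norm (y u - x u) + (Ce + 1) * \<eta>)" .
      have "y' u - x' u = (e \<sigma> - c) *\<^sub>R (g ?z' - g ?z) + (e \<sigma> - e \<rho>) *\<^sub>R g ?z"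
        by (simp add: x'_def y'_def algebra_simps)
      then have "norm (y' u - x' u) \<le> \<bar>e \<sigma> - c\<bar> * norm (g ?z' - g ?z) + \<bar>e \<sigma> - e \<rho>\<bar> * norm (g ?z)"
        by (metis norm_scaleR norm_triangle_ineq)
      also have "\<dots> \<le> R * (L * (norm (y u - x u) + (Ce + 1) * \<eta>)) + (Ce * \<eta>) * B"
        using 1 e\<sigma> eR B(2)[OF seg] R Ce \<eta>
        by (intro add_mono mult_mono) (auto simp: x_def)
      also have "\<dots> = R * L * norm (y u - x u) + M * \<eta>"
        by (simp add: M_def algebra_simps)
      also have "\<dots> \<le> M * norm (y u - x u) + M * \<eta>"
        using MRL by (intro add_right_mono mult_right_mono) auto
      finally show ?thesis by (simp add: algebra_simps)
    qed
    have start: "norm (y i - x i) \<le> C * \<eta>"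
      using elim(6) by (simp add: x_def y_def \<eta>_def)
    have small': "sqrt ((C\<^sup>2 + 1) * exp (4 * M)) * \<eta> < \<delta> / 2"
      using small by (simp add: D_def)
    show ?case
    proof
      fix u :: real assume u: "u \<in> {0..1}"
      from i show "norm (X (resc \<sigma> u) \<sigma> - X (resc \<rho> u) \<rho>) \<le> D * norm (\<sigma> - \<rho>)"
      proof
        assume "i = 0"
        have "norm (y u - x u) \<le> sqrt ((C\<^sup>2 + 1) * exp (4 * M)) * \<eta>"
          by (rule ode_difference_bound[OF cts der bound M _ _ _ _ small' u])
            (use \<eta> \<delta> start \<open>i = 0\<close> \<open>C \<ge> 0\<close> in auto)
        then show ?thesis by (simp add: x_def y_def D_def \<eta>_def)
      next
        assume "i = 1"
        \<comment> \<open>With data at the event the equation is run backwards, in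
          \<open>1 - u\<close>; the sign of the derivatives does not affect the norm in
          \<open>bound\<close>.\<close>
        have rev: "continuous_on {0..1} (\<lambda>u. f (1 - u))" if "continuous_on {0..1} f"
          for f :: "real \<Rightarrow> 'a"
          by (rule continuous_on_compose2[OF that]) (auto intro!: continuous_intros)
        have revd: "((\<lambda>u. f (1 - u)) has_vector_derivative - f' (1 - u)) (at u)"
          if "(f has_vector_derivative f' (1 - u)) (at (1 - u))" for f f' :: "real \<Rightarrow> 'a" and u
        proof -
          have "((\<lambda>u. 1 - u) has_vector_derivative -1) (at u)"
            by (auto intro!: derivative_eq_intros)
          from vector_diff_chain_at[OF this, of f] that show ?thesis by (simp add: o_def)
        qed
        have "norm (y (1 - (1 - u)) - x (1 - (1 - u))) \<le> sqrt ((C\<^sup>2 + 1) * exp (4 * M)) * \<eta>"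
        proof (rule ode_difference_bound[OF rev[OF cts(1)] rev[OF cts(2)]])
          fix w :: real assume w: "w \<in> {0<..<1}"
          show "((\<lambda>w. x (1 - w)) has_vector_derivative - x' (1 - w)) (at w)"
            "((\<lambda>w. y (1 - w)) has_vector_derivative - y' (1 - w)) (at w)"
            using w by (auto intro!: revd der)
          show "norm (- y' (1 - w) - - x' (1 - w)) \<le> M * (norm (y (1 - w) - x (1 - w)) + \<eta>)"
            if "norm (y (1 - w) - x (1 - w)) < \<delta> / 2"
            using bound[of "1 - w"] w that by (simp add: norm_minus_commute)
        qed (use M \<eta> \<delta> start \<open>i = 1\<close> \<open>C \<ge> 0\<close> small' u in auto)
        then show ?thesis by (simp add: x_def y_def D_def \<eta>_def)
      qed
    qed
  qed
  then show ?thesis using that D by blast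
qed

lemma motion_lipschitz:
  obtains B where "B \<ge> 0" "\<And>s t. s \<in> closed_segment c (e \<rho>) \<Longrightarrow> t \<in> closed_segment c (e \<rho>) \<Longrightarrow>
    norm (X t \<rho> - X s \<rho>) \<le> B * \<bar>t - s\<bar>"
proof -
  obtain B where B: "B \<ge> 0" "\<And>t. t \<in> closed_segment c (e \<rho>) \<Longrightarrow> norm (g (t, X t \<rho>, \<rho>)) \<le> B"
    by (rule g_bounded) blast
  have *: "norm (X t \<rho> - X s \<rho>) \<le> B * (t - s)"
    if st: "s \<in> closed_segment c (e \<rho>)" "t \<in> closed_segment c (e \<rho>)" "s < t" for s t
  proof -
    have "norm (X t \<rho> - X s \<rho>) \<le> B * t - B * s"
    proof (rule differentiable_bound_general[OF \<open>s < t\<close>])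
      have "{s..t} \<subseteq> closed_segment c (e \<rho>)"
        using st by (auto simp: closed_segment_eq_real_ivl split: if_splits)
      then show "continuous_on {s..t} (\<lambda>t. X t \<rho>)"
        using continuous_on_subset eventually_nhds_x_imp_x[OF cont] by blast
      show "continuous_on {s..t} ((*) B)" by (intro continuous_intros)
      fix w assume w: "s < w" "w < t"
      then have "w \<in> open_segment c (e \<rho>)"
        using st by (auto simp: closed_segment_eq_real_ivl open_segment_eq_real_ivl split: if_splits)
      then show "((\<lambda>t. X t \<rho>) has_vector_derivative g (w, X w \<rho>, \<rho>)) (at w)"
        "norm (g (w, X w \<rho>, \<rho>)) \<le> B"
        using eventually_nhds_x_imp_x[OF ode] B(2) segment_open_subset_closed by blast+
      show "((*) B has_vector_derivative B) (at w)" by (auto intro!: derivative_eq_intros)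
    qed
    then show ?thesis by (simp add: algebra_simps)
  qed
  have "norm (X t \<rho> - X s \<rho>) \<le> B * \<bar>t - s\<bar>"
    if "s \<in> closed_segment c (e \<rho>)" "t \<in> closed_segment c (e \<rho>)" for s t
    using *[of s t] *[of t s] that by (cases s t rule: linorder_cases) (auto simp: norm_minus_commute)
  then show ?thesis using that B(1) by blast
qed

text \<open>The motion for \<open>\<sigma>\<close> at \<open>s'\<close> is compared with that for
  \<open>\<rho>\<close> at the same rescaled time, a point of the same phase, and then the motion
  for \<open>\<rho>\<close> is followed to \<open>s\<close> with its speed bound. Neither motion is
  followed across its event.\<close>

lemma dependence:
  assumes i: "i = 0 \<or> i = 1"
    and start: "\<forall>\<^sub>F \<sigma> in nhds \<rho>. norm (X (resc \<sigma> i) \<sigma> - X (resc \<rho> i) \<rho>) \<le> C * norm (\<sigma> - \<rho>)"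
    and "C \<ge> 0"
  obtains D where "D \<ge> 0" "\<forall>\<^sub>F \<sigma> in nhds \<rho>. \<forall>s\<in>closed_segment c (e \<rho>). \<forall>s'\<in>closed_segment c (e \<sigma>).
    norm (X s' \<sigma> - X s \<rho>) \<le> D * (norm (\<sigma> - \<rho>) + \<bar>s' - s\<bar>)"
proof -
  obtain D where D: "D \<ge> 0" "\<forall>\<^sub>F \<sigma> in nhds \<rho>. \<forall>u\<in>{0..1}.
      norm (X (resc \<sigma> u) \<sigma> - X (resc \<rho> u) \<rho>) \<le> D * norm (\<sigma> - \<rho>)"
    by (rule dependence_rescaled[OF assms]) blast
  obtain B where B: "B \<ge> 0" "\<And>s t. s \<in> closed_segment c (e \<rho>) \<Longrightarrow> t \<in> closed_segment c (e \<rho>) \<Longrightarrow>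
      norm (X t \<rho> - X s \<rho>) \<le> B * \<bar>t - s\<bar>"
    by (rule motion_lipschitz) blast
  obtain Ce where Ce: "Ce \<ge> 0" "\<forall>\<^sub>F \<sigma> in nhds \<rho>. norm (e \<sigma> - e \<rho>) \<le> Ce * norm (\<sigma> - \<rho>)"
    by (rule differentiable_imp_locally_bounded[OF e_diff]) blast
  have "\<forall>\<^sub>F \<sigma> in nhds \<rho>. \<forall>s\<in>closed_segment c (e \<rho>). \<forall>s'\<in>closed_segment c (e \<sigma>).
      norm (X s' \<sigma> - X s \<rho>) \<le> (D + B * Ce + B) * (norm (\<sigma> - \<rho>) + \<bar>s' - s\<bar>)"
    using D(2) Ce(2)
  proof eventually_elim
    case (elim \<sigma>)
    show ?case
    proof (intro ballI)
      fix s s' assume s: "s \<in> closed_segment c (e \<rho>)" and s': "s' \<in> closed_segment c (e \<sigma>)"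
      then obtain u where u: "u \<in> {0..1}" "s' = resc \<sigma> u" using resc_segment(1) by auto
      let ?\<eta> = "norm (\<sigma> - \<rho>)" and ?w = "resc \<rho> u"
      have w: "?w \<in> closed_segment c (e \<rho>)" using u resc_segment(1) by auto
      have "s' - ?w = u * (e \<sigma> - e \<rho>)" by (simp add: u resc_def algebra_simps)
      then have "\<bar>s' - ?w\<bar> \<le> \<bar>e \<sigma> - e \<rho>\<bar>"
        using u by (simp add: abs_mult mult_left_le_one_le)
      also have "\<dots> \<le> Ce * ?\<eta>" using elim by simp
      finally have ws: "\<bar>?w - s\<bar> \<le> Ce * ?\<eta> + \<bar>s' - s\<bar>" by linarith
      have "norm (X s' \<sigma> - X s \<rho>) \<le> norm (X s' \<sigma> - X ?w \<rho>) + norm (X ?w \<rho> - X s \<rho>)"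
        using norm_triangle_ineq[of "X s' \<sigma> - X ?w \<rho>" "X ?w \<rho> - X s \<rho>"] by simp
      also have "\<dots> \<le> D * ?\<eta> + B * (Ce * ?\<eta> + \<bar>s' - s\<bar>)"
        using elim(1) u B(2)[OF s w] mult_left_mono[OF ws B(1)] by fastforce
      also have "\<dots> \<le> (D + B * Ce + B) * (?\<eta> + \<bar>s' - s\<bar>)"
        using B(1) D(1) Ce(1) by (simp add: algebra_simps)
      finally show "norm (X s' \<sigma> - X s \<rho>) \<le> (D + B * Ce + B) * (?\<eta> + \<bar>s' - s\<bar>)" .
    qed
  qed
  then show ?thesis
    using that[of "D + B * Ce + B"] B(1) D(1) Ce(1) by simp
qed

text \<open>The piece from \<open>t\<close> to the event is scaled onto \<open>[0, 1]\<close>, so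
  that pieces with the same \<open>t\<close> but different event times can be subtracted pointwise.
  \<open>A\<close> will be the projection onto the velocity.\<close>

lemma path_to_event_derivative:
  assumes A: "bounded_linear A" and t: "t \<in> closed_segment c (e \<sigma>)" "t \<noteq> e \<sigma>"
    and ct: "continuous_on (closed_segment c (e \<sigma>)) (\<lambda>t. X t \<sigma>)"
    and ode\<sigma>: "\<forall>t\<in>open_segment c (e \<sigma>). ((\<lambda>s. X s \<sigma>) has_vector_derivative g (t, X t \<sigma>, \<sigma>)) (at t)"
  shows "continuous_on {0..1} (\<lambda>w. A (X (t + w * (e \<sigma> - t)) \<sigma>))"
    and "w \<in> {0<..<1} \<Longrightarrow> t + w * (e \<sigma> - t) \<in> open_segment c (e \<sigma>)"
    and "w \<in> {0<..<1} \<Longrightarrow> ((\<lambda>w. A (X (t + w * (e \<sigma> - t)) \<sigma>)) has_vector_derivative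
      (e \<sigma> - t) *\<^sub>R A (g (t + w * (e \<sigma> - t), X (t + w * (e \<sigma> - t)) \<sigma>, \<sigma>))) (at w)"
proof -
  let ?s = "\<lambda>w. t + w * (e \<sigma> - t)"
  have "?s ` {0..1} = closed_segment t (e \<sigma>)"
    by (auto simp: closed_segment_image_interval algebra_simps intro!: image_eqI)
  then have sc: "?s ` {0..1} \<subseteq> closed_segment c (e \<sigma>)"
    using t(1) by (simp add: subset_closed_segment)
  have "continuous_on {0..1} (\<lambda>w. X (?s w) \<sigma>)"
    by (rule continuous_on_compose2[OF ct _ sc]) (intro continuous_intros)
  then show "continuous_on {0..1} (\<lambda>w. A (X (?s w) \<sigma>))"
    by (rule bounded_linear.continuous_on[OF A])
  assume w: "w \<in> {0<..<1}"
  have "?s w \<in> open_segment t (e \<sigma>)"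
    using t(2) w by (auto simp: in_segment algebra_simps intro!: exI[of _ w])
  then show so: "?s w \<in> open_segment c (e \<sigma>)"
    using t(1) subset_open_segment[of t "e \<sigma>" c "e \<sigma>"] by auto
  have "(?s has_vector_derivative (e \<sigma> - t)) (at w)"
    by (auto intro!: derivative_eq_intros)
  from vector_diff_chain_at[OF this, of "\<lambda>s. X s \<sigma>"] so ode\<sigma>
  have "((\<lambda>w. X (?s w) \<sigma>) has_vector_derivative (e \<sigma> - t) *\<^sub>R g (?s w, X (?s w) \<sigma>, \<sigma>)) (at w)"
    by (simp add: o_def)
  from bounded_linear.has_vector_derivative[OF A this]
  show "((\<lambda>w. A (X (?s w) \<sigma>)) has_vector_derivative
      (e \<sigma> - t) *\<^sub>R A (g (?s w, X (?s w) \<sigma>, \<sigma>))) (at w)"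
    by (simp add: linear_scale[OF bounded_linear.linear[OF A]])
qed

text \<open>Close to the event the acceleration is nearly constant, so the value at the event is compared
  with the value at a fixed time \<open>t\<close> just inside the phase, where differentiability in the
  parameter is known.\<close>

lemma event_value_has_derivative:
  assumes A: "bounded_linear A"
    and D: "D \<ge> 0" "\<forall>\<^sub>F \<sigma> in nhds \<rho>. \<forall>s\<in>closed_segment c (e \<rho>). \<forall>s'\<in>closed_segment c (e \<sigma>).
      norm (X s' \<sigma> - X s \<rho>) \<le> D * (norm (\<sigma> - \<rho>) + \<bar>s' - s\<bar>)"
    and V: "\<And>t. t \<in> open_segment c (e \<rho>) \<Longrightarrow> ((\<lambda>\<sigma>. A (X t \<sigma>)) has_derivative V t) (at \<rho>)"
    and W: "bounded_linear W"
    and VW: "\<And>\<epsilon>. \<epsilon> > 0 \<Longrightarrow> \<forall>\<^sub>F t in at (e \<rho>) within open_segment c (e \<rho>).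
      \<forall>h. norm (V t h - W h) \<le> \<epsilon> * norm h"
    and a: "((\<lambda>t. A (g (t, X t \<rho>, \<rho>))) \<longlongrightarrow> a) (at (e \<rho>) within open_segment c (e \<rho>))"
    and e': "(e has_derivative e') (at \<rho>)"
  shows "((\<lambda>\<sigma>. A (X (e \<sigma>) \<sigma>)) has_derivative (\<lambda>h. W h + e' h *\<^sub>R a)) (at \<rho>)"
  unfolding has_derivative_at_alt
proof (intro conjI allI impI)
  show "bounded_linear (\<lambda>h. W h + e' h *\<^sub>R a)"
    by (intro bounded_linear_add W bounded_linear_scaleR_const has_derivative_bounded_linear[OF e'])
  fix \<epsilon> :: real assume "\<epsilon> > 0"
  obtain K where K: "K \<ge> 0" "\<And>x. norm (A x) \<le> norm x * K"
    using bounded_linear.nonneg_bounded[OF A] by blast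
  obtain \<delta> L where \<delta>: "\<delta> > 0" "L \<ge> 0"
    and tube: "\<And>t z'. t \<in> closed_segment c (e \<rho>) \<Longrightarrow> dist z' (t, X t \<rho>, \<rho>) < \<delta> \<Longrightarrow>
      norm (g z' - g (t, X t \<rho>, \<rho>)) \<le> L * dist z' (t, X t \<rho>, \<rho>)"
    by (rule tube) blast
  obtain Ce where Ce: "Ce \<ge> 0" "\<forall>\<^sub>F \<sigma> in nhds \<rho>. norm (e \<sigma> - e \<rho>) \<le> Ce * norm (\<sigma> - \<rho>)"
    by (rule differentiable_imp_locally_bounded[OF e_diff]) blast
  \<comment> \<open>\<open>Q * norm (\<sigma> - \<rho>)\<close> bounds the distance of corresponding
    points of the two motions: \<open>Ce\<close> for time, \<open>D * (1 + Ce)\<close> for the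
    state, \<open>1\<close> for the parameter.\<close>
  define Q where "Q = Ce + D * (1 + Ce) + 1"
  \<comment> \<open>The error terms with \<open>\<epsilon>1\<close> add up to
    \<open>\<epsilon>1 * (Ce + 2 + norm a)\<close>, half of \<open>\<epsilon>\<close>. The other
    half pays for the Lipschitz error, made small by the time \<open>\<kappa>\<close> left until the
    event; the \<open>+ 1\<close> keeps its denominator positive.\<close>
  define \<epsilon>1 where "\<epsilon>1 = \<epsilon> / (2 * (Ce + 2 + norm a))"
  define \<kappa> where "\<kappa> = \<epsilon> / (2 * (2 * (K * L * Q) + 1))"
  have Q: "Q > 0" using Ce D by (simp add: Q_def add_nonneg_pos)
  have KLQ: "K * L * Q \<ge> 0" using K \<delta> Q by simp
  have \<epsilon>1: "\<epsilon>1 > 0" unfolding \<epsilon>1_def using \<open>\<epsilon> > 0\<close> Ce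
    by (intro divide_pos_pos mult_pos_pos add_nonneg_pos add_pos_nonneg) auto
  have \<kappa>: "\<kappa> > 0" unfolding \<kappa>_def using \<open>\<epsilon> > 0\<close> KLQ
    by (intro divide_pos_pos mult_pos_pos add_nonneg_pos) auto
  have N: "\<epsilon> / (2 * N) * N = \<epsilon> / 2" if "N > 0" for N :: real
    using that by simp
  have "2 * \<kappa> * (K * L * Q) \<le> \<kappa> * (2 * (K * L * Q) + 1)"
    using \<kappa> by (simp add: algebra_simps)
  also have "\<dots> = \<epsilon> / 2"
    unfolding \<kappa>_def by (rule N) (use KLQ in linarith)
  finally have \<kappa>\<epsilon>: "2 * \<kappa> * (K * L * Q) \<le> \<epsilon> / 2" .
  have \<epsilon>1\<epsilon>: "\<epsilon>1 * (Ce + 2 + norm a) = \<epsilon> / 2"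
    unfolding \<epsilon>1_def by (rule N) (use Ce in \<open>simp add: add_nonneg_pos add_pos_nonneg\<close>)
  have "\<forall>\<^sub>F t in at (e \<rho>) within open_segment c (e \<rho>).
      (\<forall>h. norm (V t h - W h) \<le> \<epsilon>1 * norm h) \<and> dist (A (g (t, X t \<rho>, \<rho>))) a < \<epsilon>1"
    by (intro eventually_conj VW tendstoD[OF a] \<epsilon>1)
  then obtain d where d: "d > 0" "\<And>t. t \<in> open_segment c (e \<rho>) \<Longrightarrow> \<bar>t - e \<rho>\<bar> < d \<Longrightarrow>
      (\<forall>h. norm (V t h - W h) \<le> \<epsilon>1 * norm h) \<and> norm (A (g (t, X t \<rho>, \<rho>)) - a) < \<epsilon>1"
    unfolding eventually_at by (auto simp: dist_norm open_segment_def)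
  \<comment> \<open>The cap \<open>1 / 2\<close> keeps \<open>t\<close> strictly inside the phase,
    the other bound puts it within \<open>d\<close> and \<open>\<kappa>\<close> of the event. As
    \<open>t\<close> is fixed before \<open>\<sigma>\<close> is restricted, the neighbourhood of
    \<open>\<rho>\<close> may depend on \<open>t\<close>, which is what the derivative
    \<open>V t\<close> requires.\<close>
  define \<mu> where "\<mu> = min (1 / 2) (min d \<kappa> / (2 * \<bar>c - e \<rho>\<bar>))"
  define t where "t = e \<rho> + \<mu> * (c - e \<rho>)"
  have ce: "\<bar>c - e \<rho>\<bar> > 0" using c_neq by simp
  have \<mu>: "0 < \<mu>" "\<mu> \<le> 1 / 2"
    unfolding \<mu>_def using d(1) \<kappa> ce by (simp, intro min.cobounded1)
  have t_open: "t \<in> open_segment c (e \<rho>)"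
    using c_neq \<mu> by (auto simp: in_segment t_def algebra_simps intro!: exI[of _ "1 - \<mu>"])
  have "\<bar>t - e \<rho>\<bar> = \<mu> * \<bar>c - e \<rho>\<bar>" using \<mu> by (simp add: t_def abs_mult)
  also have "\<dots> \<le> min d \<kappa> / (2 * \<bar>c - e \<rho>\<bar>) * \<bar>c - e \<rho>\<bar>"
    unfolding \<mu>_def by (intro mult_right_mono) auto
  also have "\<dots> = min d \<kappa> / 2" using ce by simp
  finally have t_near: "\<bar>t - e \<rho>\<bar> < d" "\<bar>t - e \<rho>\<bar> < \<kappa>" using d \<kappa> by auto
  have t_neq: "t \<noteq> e \<rho>" and t_closed: "t \<in> closed_segment c (e \<rho>)"
    using t_open by (auto simp: open_segment_def)
  have "\<forall>\<^sub>F \<sigma> in nhds \<rho>. norm (A (X t \<sigma>) - A (X t \<rho>) - V t (\<sigma> - \<rho>)) \<le> \<epsilon>1 * norm (\<sigma> - \<rho>)"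
    using V[OF t_open] \<epsilon>1 unfolding has_derivative_at_alt eventually_nhds_metric dist_norm by blast
  moreover have "\<forall>\<^sub>F \<sigma> in nhds \<rho>. norm (e \<sigma> - e \<rho> - e' (\<sigma> - \<rho>)) \<le> \<epsilon>1 * norm (\<sigma> - \<rho>)"
    using e' \<epsilon>1 unfolding has_derivative_at_alt eventually_nhds_metric dist_norm by blast
  \<comment> \<open>These bounds keep the perturbed motion in the tube, keep \<open>t\<close> on the
    same side of the perturbed event, and give
    \<open>\<bar>e \<sigma> - t\<bar> \<le> 2 * \<kappa>\<close>.\<close>
  moreover have "\<forall>\<^sub>F \<sigma> in nhds \<rho>. norm (\<sigma> - \<rho>) < min (\<delta> / Q) (min \<bar>t - e \<rho>\<bar> \<kappa> / (Ce + 1))"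
    using \<delta> Q t_neq \<kappa> Ce by (intro eventually_norm_less) auto
  ultimately have "\<forall>\<^sub>F \<sigma> in nhds \<rho>. norm (A (X (e \<sigma>) \<sigma>) - A (X (e \<rho>) \<rho>) -
      (W (\<sigma> - \<rho>) + e' (\<sigma> - \<rho>) *\<^sub>R a)) \<le> \<epsilon> * norm (\<sigma> - \<rho>)"
    using cont ode D(2) Ce(2)
  proof eventually_elim
    case (elim \<sigma>)
    define \<eta> where "\<eta> = norm (\<sigma> - \<rho>)"
    have \<eta>: "\<eta> \<ge> 0" "Q * \<eta> < \<delta>" "(Ce + 1) * \<eta> < \<bar>t - e \<rho>\<bar>" "(Ce + 1) * \<eta> < \<kappa>"
      using elim(3) Q Ce by (simp_all add: \<eta>_def pos_less_divide_eq mult.commute)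
    have e\<sigma>: "\<bar>e \<sigma> - e \<rho>\<bar> \<le> Ce * \<eta>" using elim(7) by (simp add: \<eta>_def)
    have "Ce * \<eta> \<le> (Ce + 1) * \<eta>" using \<eta> by (simp add: algebra_simps)
    then have e\<sigma>': "\<bar>e \<sigma> - e \<rho>\<bar> < \<bar>t - e \<rho>\<bar>" "\<bar>e \<sigma> - t\<bar> \<le> 2 * \<kappa>"
      using e\<sigma> \<eta>(3,4) t_near by linarith+
    have t\<sigma>: "t \<in> closed_segment c (e \<sigma>)" "t \<noteq> e \<sigma>"
      using t_open e\<sigma>'(1)
      by (auto simp: open_segment_eq_real_ivl closed_segment_eq_real_ivl split: if_splits)
    define s s' where "s = (\<lambda>w. t + w * (e \<rho> - t))" and "s' = (\<lambda>w. t + w * (e \<sigma> - t))"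
    note path = path_to_event_derivative[OF A t_closed t_neq eventually_nhds_x_imp_x[OF cont]
        eventually_nhds_x_imp_x[OF ode], folded s_def]
    note path' = path_to_event_derivative[OF A t\<sigma> elim(4,5), folded s'_def]
    define B where "B = 2 * \<kappa> * (K * L * Q) * \<eta> + Ce * \<epsilon>1 * \<eta>"
    \<comment> \<open>The subtracted term is the expected effect of moving the event time. What
      remains has a derivative with two parts: a short time times the difference of accelerations,
      and the shift of the event time times the deviation of the acceleration from \<open>a\<close>.
      Both are a small factor times \<open>\<eta>\<close>, and \<open>B\<close> is their
      sum.\<close>
    define \<phi> where "\<phi> = (\<lambda>w. A (X (s' w) \<sigma>) - A (X (s w) \<rho>) - (w * (e \<sigma> - e \<rho>)) *\<^sub>R a)"
    have "norm (\<phi> 1 - \<phi> 0) \<le> B * 1 - B * 0"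
    proof (rule differentiable_bound_general[OF zero_less_one])
      show "continuous_on {0..1} \<phi>"
        unfolding \<phi>_def using path(1) path'(1) by (intro continuous_intros) (simp_all add: s_def s'_def)
      show "continuous_on {0..1} ((*) B)" by (intro continuous_intros)
      fix w :: real assume "0 < w" "w < 1"
      then have w: "w \<in> {0<..<1}" by simp
      let ?z = "(s w, X (s w) \<rho>, \<rho>)" and ?z' = "(s' w, X (s' w) \<sigma>, \<sigma>)"
      show "((*) B has_vector_derivative B) (at w)" by (auto intro!: derivative_eq_intros)
      have "((\<lambda>w. A (X (s' w) \<sigma>)) has_vector_derivative (e \<sigma> - t) *\<^sub>R A (g ?z')) (at w)"
        "((\<lambda>w. A (X (s w) \<rho>)) has_vector_derivative (e \<rho> - t) *\<^sub>R A (g ?z)) (at w)"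
        using path(3)[OF w] path'(3)[OF w] by (simp_all add: s_def s'_def)
      moreover have "((\<lambda>w. (w * (e \<sigma> - e \<rho>)) *\<^sub>R a) has_vector_derivative (e \<sigma> - e \<rho>) *\<^sub>R a) (at w)"
        by (auto intro!: derivative_eq_intros simp: has_vector_derivative_def algebra_simps)
      ultimately show "(\<phi> has_vector_derivative
          (e \<sigma> - t) *\<^sub>R A (g ?z') - (e \<rho> - t) *\<^sub>R A (g ?z) - (e \<sigma> - e \<rho>) *\<^sub>R a) (at w)"
        unfolding \<phi>_def by (intro has_vector_derivative_diff)
      have so: "s w \<in> open_segment c (e \<rho>)" "s' w \<in> open_segment c (e \<sigma>)"
        using path(2)[OF w] path'(2)[OF w] by (simp_all add: s_def s'_def)
      then have sc: "s w \<in> closed_segment c (e \<rho>)" "s' w \<in> closed_segment c (e \<sigma>)"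
        by (auto simp: open_segment_def)
      have "s' w - s w = w * (e \<sigma> - e \<rho>)" by (simp add: s_def s'_def algebra_simps)
      then have "\<bar>s' w - s w\<bar> \<le> \<bar>e \<sigma> - e \<rho>\<bar>"
        using w by (simp add: abs_mult mult_left_le_one_le)
      then have ss: "\<bar>s' w - s w\<bar> \<le> Ce * \<eta>" using e\<sigma> by linarith
      have "norm (X (s' w) \<sigma> - X (s w) \<rho>) \<le> D * (\<eta> + \<bar>s' w - s w\<bar>)"
        using elim(6) sc by (simp add: \<eta>_def)
      also have "\<dots> \<le> D * (\<eta> + Ce * \<eta>)" using ss D by (intro mult_left_mono) auto
      finally have dz: "dist ?z' ?z \<le> Q * \<eta>"
        using dist_Pair3_le[of "s' w" "X (s' w) \<sigma>" \<sigma> "s w" "X (s w) \<rho>"] ss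
        by (simp add: Q_def \<eta>_def algebra_simps)
      then have "norm (g ?z' - g ?z) \<le> L * dist ?z' ?z"
        using tube[OF sc(1)] \<eta>(2) by simp
      also have "\<dots> \<le> L * (Q * \<eta>)" using dz \<delta> by (intro mult_left_mono)
      finally have "norm (g ?z' - g ?z) * K \<le> L * (Q * \<eta>) * K"
        using K by (intro mult_right_mono)
      then have 1: "norm (A (g ?z' - g ?z)) \<le> L * (Q * \<eta>) * K"
        using K(2) order_trans by blast
      have "\<bar>s w - e \<rho>\<bar> = (1 - w) * \<bar>t - e \<rho>\<bar>"
      proof -
        have "s w - e \<rho> = (1 - w) * (t - e \<rho>)" by (simp add: s_def algebra_simps)
        then show ?thesis using w by (simp add: abs_mult)
      qed
      also have "\<dots> \<le> \<bar>t - e \<rho>\<bar>" using w by (simp add: mult_left_le_one_le)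
      finally have 2: "norm (A (g ?z) - a) \<le> \<epsilon>1"
        using d(2)[OF so(1)] t_near by fastforce
      have "(e \<sigma> - t) *\<^sub>R A (g ?z') - (e \<rho> - t) *\<^sub>R A (g ?z) - (e \<sigma> - e \<rho>) *\<^sub>R a =
          (e \<sigma> - t) *\<^sub>R A (g ?z' - g ?z) + (e \<sigma> - e \<rho>) *\<^sub>R (A (g ?z) - a)"
        by (simp add: linear_diff[OF bounded_linear.linear[OF A]] algebra_simps)
      then have "norm ((e \<sigma> - t) *\<^sub>R A (g ?z') - (e \<rho> - t) *\<^sub>R A (g ?z) - (e \<sigma> - e \<rho>) *\<^sub>R a) \<le>
          \<bar>e \<sigma> - t\<bar> * norm (A (g ?z' - g ?z)) + \<bar>e \<sigma> - e \<rho>\<bar> * norm (A (g ?z) - a)"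
        using norm_triangle_ineq[of "(e \<sigma> - t) *\<^sub>R A (g ?z' - g ?z)" "(e \<sigma> - e \<rho>) *\<^sub>R (A (g ?z) - a)"]
        by simp
      also have "\<dots> \<le> (2 * \<kappa>) * (L * (Q * \<eta>) * K) + (Ce * \<eta>) * \<epsilon>1"
        using 1 2 e\<sigma> e\<sigma>' \<kappa> Ce \<eta> by (intro add_mono mult_mono) auto
      also have "\<dots> = B" by (simp add: B_def algebra_simps)
      finally show "norm ((e \<sigma> - t) *\<^sub>R A (g ?z') - (e \<rho> - t) *\<^sub>R A (g ?z) - (e \<sigma> - e \<rho>) *\<^sub>R a) \<le> B" .
    qed
    then have B: "norm (\<phi> 1 - \<phi> 0) \<le> B" by simp
    let ?h = "\<sigma> - \<rho>"
    \<comment> \<open>\<open>\<phi> 0\<close> is the difference of the values at \<open>t\<close>,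
      and \<open>\<phi> 1\<close> that at the events less
      \<open>(e \<sigma> - e \<rho>) *\<^sub>R a\<close>. The other brackets are the remainders of
      \<open>V t\<close> and \<open>e'\<close> and the gap between \<open>V t\<close> and
      \<open>W\<close>.\<close>
    have "A (X (e \<sigma>) \<sigma>) - A (X (e \<rho>) \<rho>) - (W ?h + e' ?h *\<^sub>R a) =
        (\<phi> 1 - \<phi> 0) + ((A (X t \<sigma>) - A (X t \<rho>) - V t ?h) +
        ((V t ?h - W ?h) + (e \<sigma> - e \<rho> - e' ?h) *\<^sub>R a))"
      by (simp add: \<phi>_def s_def s'_def algebra_simps)
    also have "norm \<dots> \<le> B + (\<epsilon>1 * \<eta> + (\<epsilon>1 * \<eta> + (\<epsilon>1 * \<eta>) * norm a))"
    proof (intro norm_triangle_le add_mono B)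
      show "norm (A (X t \<sigma>) - A (X t \<rho>) - V t ?h) \<le> \<epsilon>1 * \<eta>" using elim(1) by (simp add: \<eta>_def)
      show "norm (V t ?h - W ?h) \<le> \<epsilon>1 * \<eta>" using d(2)[OF t_open t_near(1)] by (simp add: \<eta>_def)
      show "norm ((e \<sigma> - e \<rho> - e' ?h) *\<^sub>R a) \<le> (\<epsilon>1 * \<eta>) * norm a"
        using elim(2) by (simp add: \<eta>_def mult_right_mono)
    qed
    also have "\<dots> = (2 * \<kappa> * (K * L * Q) + \<epsilon>1 * (Ce + 2 + norm a)) * \<eta>"
      by (simp add: B_def algebra_simps)
    also have "\<dots> \<le> \<epsilon> * \<eta>"
      using \<kappa>\<epsilon> \<epsilon>1\<epsilon> \<eta>(1) by (intro mult_right_mono) linarith+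
    finally show ?case by (simp add: \<eta>_def)
  qed
  then show "\<exists>d>0. \<forall>y. norm (y - \<rho>) < d \<longrightarrow> norm (A (X (e y) y) - A (X (e \<rho>) \<rho>) -
      (W (y - \<rho>) + e' (y - \<rho>) *\<^sub>R a)) \<le> \<epsilon> * norm (y - \<rho>)"
    unfolding eventually_nhds_metric dist_norm .
qed

end

subsection \<open>Linear algebra of the jump formula\<close>

text \<open>Turns the second-order equation into a first-order one for the pair of position and
  velocity, the form required by \<open>phase\<close>.\<close>

lemma lipschitz_near_first_order_system:
  fixes f :: "real \<Rightarrow> 'a::real_normed_vector \<Rightarrow> 'a \<Rightarrow> 'r::real_normed_vector \<Rightarrow> 'a"
  assumes "lipschitz_near (\<lambda>(t, x, y, \<rho>). f t x y \<rho>) (t, x, y, \<rho>)"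
  shows "lipschitz_near (\<lambda>(t, X, \<rho>). (snd X, f t (fst X) (snd X) \<rho>)) (t, (x, y), \<rho>)"
proof -
  have re: "lipschitz_near (\<lambda>z. (fst z, fst (fst (snd z)), snd (fst (snd z)), snd (snd z))) (t, (x, y), \<rho>)"
    by (intro lipschitz_near_bounded_linear bounded_linear_intros)
  have "lipschitz_near (\<lambda>z. snd (fst (snd z))) (t, (x, y), \<rho>)"
    by (intro lipschitz_near_bounded_linear bounded_linear_intros)
  from lipschitz_near_Pair[OF this lipschitz_near_compose[OF re, of "\<lambda>(t, x, y, \<rho>). f t x y \<rho>"]] assms
  show ?thesis by (simp add: case_prod_unfold)
qed

text \<open>Convergence of matrices is convergence in operator norm, hence uniform over directions
  relative to \<open>norm h\<close>, as \<open>event_value_has_derivative\<close> demands.\<close>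

lemma eventually_matrix_vector_mult_near:
  fixes J :: "'a \<Rightarrow> real^'n^'m"
  assumes "(J \<longlongrightarrow> J0) F" "\<epsilon> > 0"
  shows "\<forall>\<^sub>F t in F. \<forall>h. norm (J t *v h - J0 *v h) \<le> \<epsilon> * norm h"
proof -
  obtain K where K: "K > 0" "\<And>A :: real^'n^'m. \<And>h. norm (A *v h) \<le> norm A * norm h * K"
    using bounded_bilinear.pos_bounded[OF bounded_bilinear_matrix_vector_mult] by blast
  have "\<forall>\<^sub>F t in F. dist (J t) J0 < \<epsilon> / K"
    using assms K by (intro tendstoD) auto
  then show ?thesis
  proof eventually_elim
    case (elim t)
    show ?case
    proof
      fix h
      have "norm (J t *v h - J0 *v h) \<le> norm (J t - J0) * norm h * K"
        using K(2)[of "J t - J0" h] by (simp add: matrix_vector_mult_diff_rdistrib)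
      also have "\<dots> = norm (J t - J0) * K * norm h" by simp
      also have "\<dots> \<le> \<epsilon> * norm h"
        using elim K(1) by (intro mult_right_mono) (auto simp: dist_norm pos_less_divide_eq)
      finally show "norm (J t *v h - J0 *v h) \<le> \<epsilon> * norm h" .
    qed
  qed
qed

lemma dof_rows_add: "dof_rows P (A + B) = dof_rows P A + dof_rows P B"
  by (simp add: dof_rows_def matrix_add_ldistrib vec_eq_iff)

lemma dof_part_diff: "dof_part P (x - y) = dof_part P x - dof_part P y"
  by (simp add: dof_part_def matrix_vector_mult_diff_distrib vec_eq_iff)

lemma dof_rows_columnvector_mult:
  "dof_rows P (columnvector x ** R) = columnvector (dof_part P x) ** (R :: real^'p^1)"
  by (simp add: dof_rows_def dof_part_def columnvector_def matrix_matrix_mult_def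
      matrix_vector_mult_def vec_eq_iff sum_distrib_right UNIV_1 mult.assoc)

text \<open>\<open>row_derivative\<close> is the Jacobian of a map into one-dimensional vectors, so
  the product of column and row is the rank-one map that scales \<open>x\<close> by the derivative
  of the event time.\<close>

lemma row_derivative_mult:
  assumes "(\<tau> has_derivative \<tau>') (at \<rho>)"
  shows "(columnvector x ** row_derivative \<tau> \<rho>) *v h = \<tau>' h *\<^sub>R x"
proof -
  have "((\<lambda>\<sigma>. vec (\<tau> \<sigma>) :: real^1) has_derivative (\<lambda>h. vec (\<tau>' h))) (at \<rho>)"
    by (rule bounded_linear.has_derivative[OF _ assms])
      (auto simp: linear_conv_bounded_linear[symmetric] vec_eq_iff intro!: linearI)
  moreover from this have "(\<lambda>\<sigma>. vec (\<tau> \<sigma>) :: real^1) differentiable (at \<rho>)"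
    by (auto simp: differentiable_def)
  ultimately have "row_derivative \<tau> \<rho> *v h = vec (\<tau>' h)"
    unfolding row_derivative_def jacobian_works using has_derivative_unique by metis
  then have "columnvector x *v (row_derivative \<tau> \<rho> *v h) = \<tau>' h *\<^sub>R x"
    by (simp add: columnvector_def matrix_vector_mult_def vec_eq_iff UNIV_1)
  then show ?thesis by (simp only: matrix_vector_mul_assoc)
qed

theorem theorem8:
  fixes M :: "real \<Rightarrow> real^'n \<Rightarrow> real^'p \<Rightarrow> real^'n^'n"
    and F :: "real \<Rightarrow> real^'n \<Rightarrow> real^'n \<Rightarrow> real^'p \<Rightarrow> real^'n"
    and \<Phi>m :: "real \<Rightarrow> real^'n \<Rightarrow> real^'p \<Rightarrow> real^'m1"
    and \<Phi>p :: "real \<Rightarrow> real^'n \<Rightarrow> real^'p \<Rightarrow> real^'m2"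
    and \<alpha>m :: "real^'m1^'m1"
    and \<alpha>p :: "real^'m2^'m2"
    and \<xi> \<omega> :: real
    and r :: "real^'n \<Rightarrow> real"
    and U :: "(real^'p) set"
    and t0 tf :: real
    and q v :: "real \<Rightarrow> real^'p \<Rightarrow> real^'n"
    and q0 v0 :: "real^'p \<Rightarrow> real^'n"
    and teve :: "real^'p \<Rightarrow> real"
    and \<rho> :: "real^'p"
    and P :: "real^'n^('m1::finite + 'd::finite)"
    and Vm Vp :: "real^'p^'n"
    and am ap :: "real^'n"
  assumes U: "open U" "\<rho> \<in> U"
    and M_smooth: "smooth_on (\<lambda>(t, x, \<rho>). M t x \<rho>) (UNIV \<times> UNIV \<times> U)"
    and F_smooth: "smooth_on (\<lambda>(t, x, y, \<rho>). F t x y \<rho>) (UNIV \<times> UNIV \<times> UNIV \<times> U)"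
    and \<Phi>m_smooth: "smooth_on (\<lambda>(t, x, \<rho>). \<Phi>m t x \<rho>) (UNIV \<times> UNIV \<times> U)"
    and \<Phi>p_smooth: "smooth_on (\<lambda>(t, x, \<rho>). \<Phi>p t x \<rho>) (UNIV \<times> UNIV \<times> U)"
    and r_smooth: "smooth_on r UNIV"
    (* [t0, tf] isolates the event; t0 is any time after the preceding event, if there is one *)
    and event_window: "\<And>\<rho>'. \<rho>' \<in> U \<Longrightarrow> t0 < teve \<rho>' \<and> teve \<rho>' < tf"
    and initial: "\<And>\<rho>'. \<rho>' \<in> U \<Longrightarrow> q t0 \<rho>' = q0 \<rho>' \<and> v t0 \<rho>' = v0 \<rho>'"
    and initial_diff: "q0 differentiable (at \<rho>)" "v0 differentiable (at \<rho>)"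
    and eom_before: "\<And>\<rho>'. \<rho>' \<in> U \<Longrightarrow> solves_eom (f_eom M F \<alpha>m \<xi> \<omega> \<Phi>m) q v {t0<..<teve \<rho>'} \<rho>'"
    and eom_after: "\<And>\<rho>'. \<rho>' \<in> U \<Longrightarrow> solves_eom (f_eom M F \<alpha>p \<xi> \<omega> \<Phi>p) q v {teve \<rho>'<..<tf} \<rho>'"
    and Mbar_before: "\<And>\<rho>' t. \<rho>' \<in> U \<Longrightarrow> t \<in> {t0..teve \<rho>'} \<Longrightarrow> invertible (Mbar M \<alpha>m \<Phi>m t (q t \<rho>') \<rho>')"
    and Mbar_after: "\<And>\<rho>' t. \<rho>' \<in> U \<Longrightarrow> t \<in> {teve \<rho>'..tf} \<Longrightarrow> invertible (Mbar M \<alpha>p \<Phi>p t (q t \<rho>') \<rho>')"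
    (* in particular no jump of positions and velocities at teve *)
    and q_cont: "\<And>\<rho>'. \<rho>' \<in> U \<Longrightarrow> continuous_on {t0..tf} (\<lambda>t. q t \<rho>')"
    and v_cont: "\<And>\<rho>'. \<rho>' \<in> U \<Longrightarrow> continuous_on {t0..tf} (\<lambda>t. v t \<rho>')"
    and event: "\<And>\<rho>'. \<rho>' \<in> U \<Longrightarrow> r (q (teve \<rho>') \<rho>') = 0"
    and no_grazing: "frechet_derivative r (at (q (teve \<rho>) \<rho>)) (v (teve \<rho>) \<rho>) \<noteq> 0"
    and teve_diff: "teve differentiable (at \<rho>)"
    and constraint_before: "\<Phi>m (teve \<rho>) (q (teve \<rho>) \<rho>) \<rho> = 0"
    and constraint_after: "\<Phi>p (teve \<rho>) (q (teve \<rho>) \<rho>) \<rho> \<noteq> 0"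
    and full_rank: "rank (partial_q \<Phi>m (teve \<rho>) (q (teve \<rho>) \<rho>) \<rho>) = CARD('m1)"
    and P_perm: "permutation_matrix P"
    and P_dep: "invertible (dep_columns P (partial_q \<Phi>m (teve \<rho>) (q (teve \<rho>) \<rho>) \<rho>))"
    and v_diff: "\<And>t. t \<in> {t0<..<tf} - {teve \<rho>} \<Longrightarrow> v t differentiable (at \<rho>)"
    and Vm: "((\<lambda>t. velocity_sensitivity v t \<rho>) \<longlongrightarrow> Vm) (at_left (teve \<rho>))"
    and Vp: "((\<lambda>t. velocity_sensitivity v t \<rho>) \<longlongrightarrow> Vp) (at_right (teve \<rho>))"
    and am: "((\<lambda>t. acceleration v t \<rho>) \<longlongrightarrow> am) (at_left (teve \<rho>))"
    and ap: "((\<lambda>t. acceleration v t \<rho>) \<longlongrightarrow> ap) (at_right (teve \<rho>))"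
  shows "dof_rows P Vp =
         dof_rows P Vm + columnvector (dof_part P am - dof_part P ap) ** row_derivative teve \<rho>"
proof -
  define X where "X = (\<lambda>t \<sigma>. (q t \<sigma>, v t \<sigma>))"
  define gm where "gm = (\<lambda>(t, X, \<sigma>). (snd X, f_eom M F \<alpha>m \<xi> \<omega> \<Phi>m t (fst X) (snd X) \<sigma>))"
  define gp where "gp = (\<lambda>(t, X, \<sigma>). (snd X, f_eom M F \<alpha>p \<xi> \<omega> \<Phi>p t (fst X) (snd X) \<sigma>))"
  have evU: "\<forall>\<^sub>F \<sigma> in nhds \<rho>. \<sigma> \<in> U"
    using U by (rule eventually_nhds_in_open)
  have seg: "closed_segment t0 (teve \<sigma>) = {t0..teve \<sigma>}" "open_segment t0 (teve \<sigma>) = {t0<..<teve \<sigma>}"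
    "closed_segment tf (teve \<sigma>) = {teve \<sigma>..tf}" "open_segment tf (teve \<sigma>) = {teve \<sigma><..<tf}"
    if "\<sigma> \<in> U" for \<sigma>
    using event_window[OF that] by (auto simp: closed_segment_eq_real_ivl open_segment_eq_real_ivl)
  have X_cont: "continuous_on {t0..tf} (\<lambda>t. X t \<sigma>)" if "\<sigma> \<in> U" for \<sigma>
    unfolding X_def by (intro continuous_on_Pair q_cont v_cont that)
  interpret before: phase X gm t0 teve \<rho>
  proof
    show "teve \<rho> \<noteq> t0" using event_window[OF U(2)] by simp
    show "\<forall>\<^sub>F \<sigma> in nhds \<rho>. continuous_on (closed_segment t0 (teve \<sigma>)) (\<lambda>t. X t \<sigma>)"
      using evU by eventually_elim
        (use event_window in \<open>force simp: seg intro: continuous_on_subset[OF X_cont]\<close>)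
    show "\<forall>\<^sub>F \<sigma> in nhds \<rho>. \<forall>t\<in>open_segment t0 (teve \<sigma>).
        ((\<lambda>s. X s \<sigma>) has_vector_derivative gm (t, X t \<sigma>, \<sigma>)) (at t)"
      using evU by eventually_elim
        (use eom_before in \<open>auto simp: seg solves_eom_def X_def gm_def intro!: has_vector_derivative_Pair\<close>)
    show "lipschitz_near gm (t, X t \<rho>, \<rho>)" if "t \<in> closed_segment t0 (teve \<rho>)" for t
      unfolding gm_def X_def
      by (intro lipschitz_near_first_order_system lipschitz_near_f_eom[OF U M_smooth F_smooth \<Phi>m_smooth])
        (use that U Mbar_before seg in blast)
  qed (fact teve_diff)
  \<comment> \<open>The fixed end is \<open>tf\<close>, so the segment runs backwards and the event
    again sits at rescaled time 1.\<close>
  interpret after: phase X gp tf teve \<rho>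
  proof
    show "teve \<rho> \<noteq> tf" using event_window[OF U(2)] by simp
    show "\<forall>\<^sub>F \<sigma> in nhds \<rho>. continuous_on (closed_segment tf (teve \<sigma>)) (\<lambda>t. X t \<sigma>)"
      using evU by eventually_elim
        (use event_window in \<open>force simp: seg intro: continuous_on_subset[OF X_cont]\<close>)
    show "\<forall>\<^sub>F \<sigma> in nhds \<rho>. \<forall>t\<in>open_segment tf (teve \<sigma>).
        ((\<lambda>s. X s \<sigma>) has_vector_derivative gp (t, X t \<sigma>, \<sigma>)) (at t)"
      using evU by eventually_elim
        (use eom_after in \<open>auto simp: seg solves_eom_def X_def gp_def intro!: has_vector_derivative_Pair\<close>)
    show "lipschitz_near gp (t, X t \<rho>, \<rho>)" if "t \<in> closed_segment tf (teve \<rho>)" for t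
      unfolding gp_def X_def
      by (intro lipschitz_near_first_order_system lipschitz_near_f_eom[OF U M_smooth F_smooth \<Phi>p_smooth])
        (use that U Mbar_after seg in blast)
  qed (fact teve_diff)
  have "(\<lambda>\<sigma>. (q0 \<sigma>, v0 \<sigma>)) differentiable (at \<rho>)"
    using initial_diff by (auto simp: differentiable_def intro: has_derivative_Pair)
  then obtain C0 where C0: "C0 \<ge> 0"
    "\<forall>\<^sub>F \<sigma> in nhds \<rho>. norm ((q0 \<sigma>, v0 \<sigma>) - (q0 \<rho>, v0 \<rho>)) \<le> C0 * norm (\<sigma> - \<rho>)"
    by (rule differentiable_imp_locally_bounded) blast
  have "\<forall>\<^sub>F \<sigma> in nhds \<rho>. norm (X (before.resc \<sigma> 0) \<sigma> - X (before.resc \<rho> 0) \<rho>) \<le> C0 * norm (\<sigma> - \<rho>)"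
    using C0(2) evU by eventually_elim (simp add: before.resc_def X_def initial U)
  then obtain D1 where D1: "D1 \<ge> 0"
    "\<forall>\<^sub>F \<sigma> in nhds \<rho>. \<forall>s\<in>closed_segment t0 (teve \<rho>). \<forall>s'\<in>closed_segment t0 (teve \<sigma>).
      norm (X s' \<sigma> - X s \<rho>) \<le> D1 * (norm (\<sigma> - \<rho>) + \<bar>s' - s\<bar>)"
    by (rule before.dependence[OF disjI1[OF refl] _ C0(1)]) blast
  obtain Ce where Ce: "Ce \<ge> 0" "\<forall>\<^sub>F \<sigma> in nhds \<rho>. norm (teve \<sigma> - teve \<rho>) \<le> Ce * norm (\<sigma> - \<rho>)"
    by (rule differentiable_imp_locally_bounded[OF teve_diff]) blast
  \<comment> \<open>At rescaled time 1 both phases share the state at the event. The bound of the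
    first phase, taken at the two event times, supplies the data of the second; \<open>Ce\<close>
    accounts for the distance of these times.\<close>
  have "\<forall>\<^sub>F \<sigma> in nhds \<rho>. norm (X (after.resc \<sigma> 1) \<sigma> - X (after.resc \<rho> 1) \<rho>) \<le>
      (D1 * (1 + Ce)) * norm (\<sigma> - \<rho>)"
    using D1(2) Ce(2)
  proof eventually_elim
    case (elim \<sigma>)
    have "norm (X (teve \<sigma>) \<sigma> - X (teve \<rho>) \<rho>) \<le> D1 * (norm (\<sigma> - \<rho>) + \<bar>teve \<sigma> - teve \<rho>\<bar>)"
      using elim(1) by simp
    also have "\<dots> \<le> D1 * (norm (\<sigma> - \<rho>) + Ce * norm (\<sigma> - \<rho>))"
      using elim(2) D1(1) by (intro mult_left_mono) auto
    finally show ?case by (simp add: after.resc_def algebra_simps)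
  qed
  then obtain D2 where D2: "D2 \<ge> 0"
    "\<forall>\<^sub>F \<sigma> in nhds \<rho>. \<forall>s\<in>closed_segment tf (teve \<rho>). \<forall>s'\<in>closed_segment tf (teve \<sigma>).
      norm (X s' \<sigma> - X s \<rho>) \<le> D2 * (norm (\<sigma> - \<rho>) + \<bar>s' - s\<bar>)"
    by (rule after.dependence[OF disjI2[OF refl]]) (use D1(1) Ce(1) in \<open>simp, blast\<close>)
  obtain \<tau>' where \<tau>': "(teve has_derivative \<tau>') (at \<rho>)"
    using teve_diff by (auto simp: differentiable_def)
  have V: "((\<lambda>\<sigma>. snd (X t \<sigma>)) has_derivative (\<lambda>h. velocity_sensitivity v t \<rho> *v h)) (at \<rho>)"
    if "t \<in> {t0<..<tf} - {teve \<rho>}" for t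
    using v_diff[OF that] by (simp add: X_def velocity_sensitivity_def jacobian_works)
  have acc: "snd (gm (t, X t \<rho>, \<rho>)) = acceleration v t \<rho>" if "t \<in> {t0<..<teve \<rho>}" for t
    using eom_before[OF U(2)] that vector_derivative_at
    by (fastforce simp: solves_eom_def gm_def X_def acceleration_def)
  have acc': "snd (gp (t, X t \<rho>, \<rho>)) = acceleration v t \<rho>" if "t \<in> {teve \<rho><..<tf}" for t
    using eom_after[OF U(2)] that vector_derivative_at
    by (fastforce simp: solves_eom_def gp_def X_def acceleration_def)
  have "((\<lambda>\<sigma>. snd (X (teve \<sigma>) \<sigma>)) has_derivative (\<lambda>h. Vm *v h + \<tau>' h *\<^sub>R am)) (at \<rho>)"
  proof (rule before.event_value_has_derivative[OF bounded_linear_snd D1 _ _ _ _ \<tau>'])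
    show "((\<lambda>t. snd (gm (t, X t \<rho>, \<rho>))) \<longlongrightarrow> am) (at (teve \<rho>) within open_segment t0 (teve \<rho>))"
    proof (rule Lim_transform_eventually)
      show "((\<lambda>t. acceleration v t \<rho>) \<longlongrightarrow> am) (at (teve \<rho>) within open_segment t0 (teve \<rho>))"
        by (rule tendsto_within_subset[OF am]) (auto simp: seg[OF U(2)])
      show "\<forall>\<^sub>F t in at (teve \<rho>) within open_segment t0 (teve \<rho>).
          acceleration v t \<rho> = snd (gm (t, X t \<rho>, \<rho>))"
        unfolding eventually_at_filter seg[OF U(2)] by (simp add: acc)
    qed
    show "\<forall>\<^sub>F t in at (teve \<rho>) within open_segment t0 (teve \<rho>).
        \<forall>h. norm (velocity_sensitivity v t \<rho> *v h - Vm *v h) \<le> \<epsilon> * norm h" if "\<epsilon> > 0" for \<epsilon>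
      by (rule eventually_matrix_vector_mult_near[OF tendsto_within_subset[OF Vm] that])
        (auto simp: seg[OF U(2)])
  qed (use event_window[OF U(2)] in \<open>auto simp: seg[OF U(2)] matrix_vector_mul_bounded_linear intro!: V\<close>)
  moreover have "((\<lambda>\<sigma>. snd (X (teve \<sigma>) \<sigma>)) has_derivative (\<lambda>h. Vp *v h + \<tau>' h *\<^sub>R ap)) (at \<rho>)"
  proof (rule after.event_value_has_derivative[OF bounded_linear_snd D2 _ _ _ _ \<tau>'])
    show "((\<lambda>t. snd (gp (t, X t \<rho>, \<rho>))) \<longlongrightarrow> ap) (at (teve \<rho>) within open_segment tf (teve \<rho>))"
    proof (rule Lim_transform_eventually)
      show "((\<lambda>t. acceleration v t \<rho>) \<longlongrightarrow> ap) (at (teve \<rho>) within open_segment tf (teve \<rho>))"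
        by (rule tendsto_within_subset[OF ap]) (auto simp: seg[OF U(2)])
      show "\<forall>\<^sub>F t in at (teve \<rho>) within open_segment tf (teve \<rho>).
          acceleration v t \<rho> = snd (gp (t, X t \<rho>, \<rho>))"
        unfolding eventually_at_filter seg[OF U(2)] by (simp add: acc')
    qed
    show "\<forall>\<^sub>F t in at (teve \<rho>) within open_segment tf (teve \<rho>).
        \<forall>h. norm (velocity_sensitivity v t \<rho> *v h - Vp *v h) \<le> \<epsilon> * norm h" if "\<epsilon> > 0" for \<epsilon>
      by (rule eventually_matrix_vector_mult_near[OF tendsto_within_subset[OF Vp] that])
        (auto simp: seg[OF U(2)])
  qed (use event_window[OF U(2)] in \<open>auto simp: seg[OF U(2)] matrix_vector_mul_bounded_linear intro!: V\<close>)
  ultimately have "(\<lambda>h. Vp *v h + \<tau>' h *\<^sub>R ap) = (\<lambda>h. Vm *v h + \<tau>' h *\<^sub>R am)"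
    by (rule has_derivative_unique[symmetric])
  then have "Vp *v h = Vm *v h + \<tau>' h *\<^sub>R (am - ap)" for h
    by (metis (no_types, lifting) add_diff_cancel_right' add_diff_eq scaleR_diff_right)
  then have "Vp *v h = (Vm + columnvector (am - ap) ** row_derivative teve \<rho>) *v h" for h
    by (simp add: matrix_vector_mult_add_rdistrib row_derivative_mult[OF \<tau>'])
  then have "Vp = Vm + columnvector (am - ap) ** row_derivative teve \<rho>"
    by (simp add: matrix_eq)
  then show ?thesis
    by (simp add: dof_rows_add dof_rows_columnvector_mult dof_part_diff)
qed

end
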